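(* Let $N^{n+1}$ be a locally symmetric space with the property that the first and second elementary symmetric polynomials of the eigenvalues of its Jacobi operator $K_\xi$ are constant and independent of the choice of the unit tangent vector $\xi\in\mathcal{T}N$. Then any $1$-isoparametric hypersurface in $N$ is $2$-isoparametric; additionally, any $3$-isoparametric hypersurface in $N$ is $4$-isoparametric.
   Context: The Jacobi operator of a unit tangent vector $\xi$ is $K_\xi(X)=R(\xi,X)\xi$ with the sign convention $R(X,Y)=\nabla_{[X,Y]}-[\nabla_X,\nabla_Y]$. For an operator $A$ with real eigenvalues, $\sigma_i(A)$ denotes the $i$-th elementary symmetric polynomial of its eigenvalues. For $1\le k\le n$, a non-constant smooth function $f$ on a Riemannian manifold $N^{n+1}$ (or on an open subset of it) is called $k$-isoparametric if there are a smooth function $b:\mathbb{R}\to\mathbb{R}$ and continuous functions $a_1,\dots,a_k:\mathbb{R}\to\mathbb{R}$ such that $|\nabla f|^2=b(f)$ and $\sigma_i(H_f)=a_i(f)$ for $i=1,\dots,k$, where $H_f$ is the Hessian of $f$. A hypersurface $M^n\subset N^{n+1}$ is called $k$-isoparametric if it is a level hypersurface $f^{-1}(t_0)$ ($t_0$ a regular value) of some $k$-isoparametric function $f$ defined locally, i.e. on an open subset of $N$. The notion is only considered for $k\le n$, so $n\ge2$ in the first assertion and $n\ge4$ in the second. *)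

theory Defs
  imports "HOL-Analysis.Analysis" "HOL-Computational_Algebra.Polynomial" "HOL-Library.Multiset"
begin

section \<open>Smooth maps on open subsets of Euclidean spaces\<close>

(* Ck_on k S f is meant for open S: the derivative at a point of S is the two-sided one. *)
primrec Ck_on ::
  "nat \<Rightarrow> 'a::euclidean_space set \<Rightarrow> ('a \<Rightarrow> 'b::euclidean_space) \<Rightarrow> bool" where
  "Ck_on 0 S f \<longleftrightarrow> continuous_on S f"
| "Ck_on (Suc k) S f \<longleftrightarrow>
     (\<forall>x\<in>S. f differentiable (at x)) \<and> (\<forall>v. Ck_on k S (\<lambda>x. frechet_derivative f (at x) v))"

definition smooth_on :: "'a::euclidean_space set \<Rightarrow> ('a \<Rightarrow> 'b::euclidean_space) \<Rightarrow> bool" where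
  "smooth_on S f \<longleftrightarrow> (\<forall>k. Ck_on k S f)"


section \<open>Elementary symmetric polynomials of the eigenvalues of an operator\<close>

definition charpoly :: "real^'d^'d \<Rightarrow> real poly" where
  "charpoly A = det (\<chi> i j. (if i = j then [:0, 1:] else 0) - [:A $ i $ j:])"

(* Real eigenvalues, counted with algebraic multiplicity. *)
definition eigenvalues :: "real^'d^'d \<Rightarrow> real multiset" where
  "eigenvalues A = proots (charpoly A)"

definition elem_sym :: "nat \<Rightarrow> real list \<Rightarrow> real" where
  "elem_sym k xs = (\<Sum>I | I \<subseteq> {..<length xs} \<and> card I = k. \<Prod>j\<in>I. xs ! j)"

(* elem_sym does not depend on the order of the list; sorting merely fixes an enumeration. *)
definition sigma_op :: "nat \<Rightarrow> real^'d^'d \<Rightarrow> real" where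
  "sigma_op k A = elem_sym k (sorted_list_of_multiset (eigenvalues A))"


section \<open>Riemannian geometry in one coordinate chart\<close>

(* Here G is the matrix (g_ij) of the metric as a function of the coordinates, and vector fields
   are given by their components with respect to the coordinate frame. *)

type_synonym 'd vfield = "real^'d \<Rightarrow> real^'d"
type_synonym 'd metric_field = "real^'d \<Rightarrow> real^'d^'d"

definition metric_at :: "'d::finite metric_field \<Rightarrow> real^'d \<Rightarrow> real^'d \<Rightarrow> real^'d \<Rightarrow> real" where
  "metric_at G x u v = u \<bullet> (G x *v v)"

definition partial :: "'d::finite \<Rightarrow> (real^'d \<Rightarrow> real) \<Rightarrow> real^'d \<Rightarrow> real" where
  "partial i F x = frechet_derivative F (at x) (axis i 1)"

definition christoffel ::
  "'d::finite metric_field \<Rightarrow> real^'d \<Rightarrow> 'd \<Rightarrow> 'd \<Rightarrow> 'd \<Rightarrow> real" where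
  "christoffel G x k i j =
     (1/2) * (\<Sum>l\<in>UNIV. matrix_inv (G x) $ k $ l *
        (partial i (\<lambda>y. G y $ j $ l) x + partial j (\<lambda>y. G y $ i $ l) x
          - partial l (\<lambda>y. G y $ i $ j) x))"

(* Levi-Civita connection: cov G X Y is the covariant derivative of Y in direction X. *)
definition cov :: "'d::finite metric_field \<Rightarrow> 'd vfield \<Rightarrow> 'd vfield \<Rightarrow> 'd vfield" where
  "cov G X Y x = frechet_derivative Y (at x) (X x) +
     (\<chi> k. \<Sum>i\<in>UNIV. \<Sum>j\<in>UNIV. christoffel G x k i j * X x $ i * Y x $ j)"

definition lie_bracket :: "'d::finite vfield \<Rightarrow> 'd vfield \<Rightarrow> 'd vfield" where
  "lie_bracket X Y x = frechet_derivative Y (at x) (X x) - frechet_derivative X (at x) (Y x)"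

(* Sign convention: R(X,Y) = \<nabla>_[X,Y] - [\<nabla>_X, \<nabla>_Y]. *)
definition curv ::
  "'d::finite metric_field \<Rightarrow> 'd vfield \<Rightarrow> 'd vfield \<Rightarrow> 'd vfield \<Rightarrow> 'd vfield" where
  "curv G X Y Z x =
     cov G (lie_bracket X Y) Z x - (cov G X (cov G Y Z) x - cov G Y (cov G X Z) x)"

definition nabla_curv ::
  "'d::finite metric_field \<Rightarrow> 'd vfield \<Rightarrow> 'd vfield \<Rightarrow> 'd vfield \<Rightarrow> 'd vfield \<Rightarrow> 'd vfield" where
  "nabla_curv G W X Y Z x =
     cov G W (curv G X Y Z) x - curv G (cov G W X) Y Z x
       - curv G X (cov G W Y) Z x - curv G X Y (cov G W Z) x"

(* K_xi(v) = R(xi, v) xi.  The curvature is tensorial, so its value on tangent vectors at a point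
   may be computed with any extension to vector fields; here the constant-component ones. *)
definition jacobi_op :: "'d::finite metric_field \<Rightarrow> real^'d \<Rightarrow> real^'d \<Rightarrow> real^'d^'d" where
  "jacobi_op G x \<xi> = matrix (\<lambda>v. curv G (\<lambda>_. \<xi>) (\<lambda>_. v) (\<lambda>_. \<xi>) x)"

definition gradient :: "'d::finite metric_field \<Rightarrow> (real^'d \<Rightarrow> real) \<Rightarrow> 'd vfield" where
  "gradient G F x = matrix_inv (G x) *v (\<chi> i. partial i F x)"

(* The Hessian as the operator v \<mapsto> \<nabla>_v (grad F). *)
definition hessian_op ::
  "'d::finite metric_field \<Rightarrow> (real^'d \<Rightarrow> real) \<Rightarrow> real^'d \<Rightarrow> real^'d^'d" where
  "hessian_op G F x = matrix (\<lambda>v. cov G (\<lambda>_. v) (gradient G F) x)"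


section \<open>Riemannian manifolds\<close>

(* A chart is its domain together with its coordinate map.  A Riemannian metric is given by its
   coordinate matrices in the charts of a smooth atlas, subject to the transformation law. *)

type_synonym ('p, 'd) chart = "'p set \<times> ('p \<Rightarrow> real^'d)"

abbreviation cdom :: "('p, 'd::finite) chart \<Rightarrow> 'p set" where "cdom c \<equiv> fst c"
abbreviation cmap :: "('p, 'd::finite) chart \<Rightarrow> 'p \<Rightarrow> real^'d" where "cmap c \<equiv> snd c"
abbreviation cinv :: "('p, 'd::finite) chart \<Rightarrow> real^'d \<Rightarrow> 'p" where
  "cinv c \<equiv> inv_into (cdom c) (cmap c)"

locale riemannian_manifold =
  fixes N :: "'p topology"
    and \<A> :: "('p, 'd::finite) chart set"
    and g :: "('p, 'd) chart \<Rightarrow> 'd metric_field"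
  assumes Hausdorff: "Hausdorff_space N"
    and second_countable: "second_countable N"
    and covering: "(\<Union>c\<in>\<A>. cdom c) = topspace N"
    and chart_open: "c \<in> \<A> \<Longrightarrow> openin N (cdom c) \<and> open (cmap c ` cdom c)"
    and chart_homeomorphic: "c \<in> \<A> \<Longrightarrow>
      homeomorphic_map (subtopology N (cdom c)) (top_of_set (cmap c ` cdom c)) (cmap c)"
    and transition_smooth: "c \<in> \<A> \<Longrightarrow> c' \<in> \<A> \<Longrightarrow>
      smooth_on (cmap c ` (cdom c \<inter> cdom c')) (cmap c' \<circ> cinv c)"
    and metric_smooth: "c \<in> \<A> \<Longrightarrow> smooth_on (cmap c ` cdom c) (g c)"
    and metric_sym: "c \<in> \<A> \<Longrightarrow> x \<in> cmap c ` cdom c \<Longrightarrow>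
      metric_at (g c) x u v = metric_at (g c) x v u"
    and metric_pos: "c \<in> \<A> \<Longrightarrow> x \<in> cmap c ` cdom c \<Longrightarrow> u \<noteq> 0 \<Longrightarrow>
      metric_at (g c) x u u > 0"
    and metric_transform: "c \<in> \<A> \<Longrightarrow> c' \<in> \<A> \<Longrightarrow> p \<in> cdom c \<inter> cdom c' \<Longrightarrow>
      metric_at (g c) (cmap c p) u v =
        metric_at (g c') (cmap c' p)
          (frechet_derivative (cmap c' \<circ> cinv c) (at (cmap c p)) u)
          (frechet_derivative (cmap c' \<circ> cinv c) (at (cmap c p)) v)"

(* Parallel curvature tensor. *)
definition locally_symmetric ::
  "('p, 'd::finite) chart set \<Rightarrow> (('p, 'd) chart \<Rightarrow> 'd metric_field) \<Rightarrow> bool" where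
  "locally_symmetric \<A> g \<longleftrightarrow>
     (\<forall>c\<in>\<A>. \<forall>W X Y Z. \<forall>x \<in> cmap c ` cdom c.
        smooth_on (cmap c ` cdom c) W \<longrightarrow> smooth_on (cmap c ` cdom c) X \<longrightarrow>
        smooth_on (cmap c ` cdom c) Y \<longrightarrow> smooth_on (cmap c ` cdom c) Z \<longrightarrow>
        nabla_curv (g c) W X Y Z x = 0)"

(* One and the same constant for all unit tangent vectors of N. *)
definition jacobi_sigma_constant ::
  "('p, 'd::finite) chart set \<Rightarrow> (('p, 'd) chart \<Rightarrow> 'd metric_field) \<Rightarrow> nat \<Rightarrow> bool" where
  "jacobi_sigma_constant \<A> g i \<longleftrightarrow>
     (\<exists>C. \<forall>c\<in>\<A>. \<forall>x \<in> cmap c ` cdom c. \<forall>\<xi>.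
        metric_at (g c) x \<xi> \<xi> = 1 \<longrightarrow> sigma_op i (jacobi_op (g c) x \<xi>) = C)"


section \<open>Isoparametric functions and hypersurfaces\<close>

(* CARD('d) is n+1, so the condition k < CARD('d) reads k \<le> n. *)
definition isoparametric_function ::
  "'p topology \<Rightarrow> ('p, 'd::finite) chart set \<Rightarrow> (('p, 'd) chart \<Rightarrow> 'd metric_field) \<Rightarrow>
     nat \<Rightarrow> 'p set \<Rightarrow> ('p \<Rightarrow> real) \<Rightarrow> bool" where
  "isoparametric_function N \<A> g k U f \<longleftrightarrow>
     1 \<le> k \<and> k < CARD('d) \<and> openin N U \<and> \<not> f constant_on U \<and>
     (\<forall>c\<in>\<A>. smooth_on (cmap c ` (U \<inter> cdom c)) (f \<circ> cinv c)) \<and>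
     (\<exists>(b :: real \<Rightarrow> real) (a :: nat \<Rightarrow> real \<Rightarrow> real).
        smooth_on UNIV b \<and> (\<forall>i\<in>{1..k}. continuous_on UNIV (a i)) \<and>
        (\<forall>c\<in>\<A>. \<forall>p \<in> U \<inter> cdom c.
           (let x = cmap c p; F = f \<circ> cinv c in
             metric_at (g c) x (gradient (g c) F x) (gradient (g c) F x) = b (f p) \<and>
             (\<forall>i\<in>{1..k}. sigma_op i (hessian_op (g c) F x) = a i (f p)))))"

definition regular_value ::
  "('p, 'd::finite) chart set \<Rightarrow> 'p set \<Rightarrow> ('p \<Rightarrow> real) \<Rightarrow> real \<Rightarrow> bool" where
  "regular_value \<A> U f t \<longleftrightarrow>
     (\<forall>c\<in>\<A>. \<forall>p \<in> U \<inter> cdom c. f p = t \<longrightarrow>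
        frechet_derivative (f \<circ> cinv c) (at (cmap c p)) \<noteq> (\<lambda>_. 0))"

(* A hypersurface is required to be nonempty. *)
definition isoparametric_hypersurface ::
  "'p topology \<Rightarrow> ('p, 'd::finite) chart set \<Rightarrow> (('p, 'd) chart \<Rightarrow> 'd metric_field) \<Rightarrow>
     nat \<Rightarrow> 'p set \<Rightarrow> bool" where
  "isoparametric_hypersurface N \<A> g k M \<longleftrightarrow>
     M \<noteq> {} \<and>
     (\<exists>U f t. isoparametric_function N \<A> g k U f \<and> regular_value \<A> U f t \<and>
        M = {p \<in> U. f p = t})"

end

(* Let f have |grad f|^2 = b(f) and put V = grad f. On {b(f) > 0} the Hessian H and the Jacobi
   operator K = K_V satisfy, along V and up to commutators with the connection matrix,
   H' = -K - H^2 + (b'/2) H + (b''/2) V df   and   K' = b' K   (the latter by local symmetry).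
   Taking traces, with tr K = b C1 and tr K^2 = b^2 (C1^2 - 2 C2):
     (tr H)'    expresses tr H^2 by tr H and f;
     (tr H^2)'  expresses tr KH by tr H^2, tr H^3 and f;
     (tr KH)'   expresses tr KH^2 by tr KH and f;
     (tr H^3)'  expresses tr H^4 by tr H^3, tr KH^2 and f.
   If a function is constant on the level sets of f, so is its derivative along V, since V is
   transversal to them; Newton's identities translate traces of powers into the sigma_i. *)
theory Submission
  imports Defs
begin

section \<open>Calculus of \<open>C\<^sup>k\<close> maps\<close>

text \<open>A coordinate derivative differs from the covariant one by a commutator with the
  connection matrix; cyclicity of the trace removes these commutators. Differentiating |V|^2 = b(f)
  gives HV = (b'/2)V, that is \<nabla>_V V = (b'/2)V. This is the source of the b'' term, it makes
  all traces containing V df computable, and it explains K' = b'K: each of the two slots of K filled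
  by V contributes b'/2. As \<open>sigma_op\<close> sees only real roots of the characteristic
  polynomial, passing to traces requires H and K to be self-adjoint for the metric, hence
  diagonalizable. The obstacle is the regularity of the coefficients. Constancy on level sets yields
  only some function q of the value of f, common to all charts and a priori without regularity; yet
  it must be differentiated, and the last one must be replaced by a continuous function on the whole
  real line. Both are done on a short curve transversal to the level sets and parametrized by the
  value of f, where q is read off from a function on the chart. Since b > 0 is guaranteed only near
  the regular level, f is restricted to a slab l < f < u around it.\<close>

abbreviation dd :: "('a::real_normed_vector \<Rightarrow> 'b::real_normed_vector) \<Rightarrow> 'a \<Rightarrow> 'a \<Rightarrow> 'b" where
  "dd f x v \<equiv> frechet_derivative f (at x) v"

lemma dd_eq: "(f has_derivative f') (at x) \<Longrightarrow> dd f x v = f' v"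
  by (metis frechet_derivative_at)

lemma has_derivative_dd: "f differentiable (at x) \<Longrightarrow> (f has_derivative dd f x) (at x)"
  by (simp add: frechet_derivative_works)

lemma dd_cong:
  assumes "f differentiable (at x)" "open S" "x \<in> S" "\<And>y. y \<in> S \<Longrightarrow> f y = g y"
  shows "dd f x v = dd g x v"
  using frechet_derivative_transform_within_open[OF assms] by simp

lemma differentiable_cong_open:
  assumes "f differentiable (at x)" "open S" "x \<in> S" "\<And>y. y \<in> S \<Longrightarrow> f y = g y"
  shows "g differentiable (at x)"
  using has_derivative_transform_within_open[OF has_derivative_dd[OF assms(1)] assms(2,3,4)]
  by (auto simp: differentiable_def)

text \<open>Product and chain rules describe a derivative only at points of S, whereas
  \<open>Ck_on\<close> speaks of the total function \<open>dd f\<close>. Openness of S makes the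
  values outside irrelevant; the closure properties below replace derivatives by explicit formulas
  in this way.\<close>

lemma Ck_on_cong_imp:
  assumes "open S" "\<And>x. x \<in> S \<Longrightarrow> f x = g x" "Ck_on k S f"
  shows "Ck_on k S g"
  using assms(2,3)
proof (induction k arbitrary: f g)
  case 0
  then show ?case
    by (metis Ck_on.simps(1) continuous_on_cong)
next
  case (Suc k)
  have df: "f differentiable (at x)" if "x \<in> S" for x
    using Suc.prems that by simp
  have "Ck_on k S (\<lambda>x. dd g x v)" for v
    by (rule Suc.IH[of "\<lambda>x. dd f x v"])
       (use Suc.prems assms(1) df in \<open>auto intro!: dd_cong\<close>)
  moreover have "g differentiable (at x)" if "x \<in> S" for x
    using differentiable_cong_open[OF df assms(1)] that Suc.prems by blast
  ultimately show ?case by simp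
qed

lemma Ck_on_subset: "Ck_on k S f \<Longrightarrow> T \<subseteq> S \<Longrightarrow> Ck_on k T f"
  by (induction k arbitrary: f) (auto intro: continuous_on_subset)

lemma smooth_on_subset: "smooth_on S f \<Longrightarrow> T \<subseteq> S \<Longrightarrow> smooth_on T f"
  unfolding smooth_on_def using Ck_on_subset by metis

lemma Ck_on_continuous: "Ck_on k S f \<Longrightarrow> continuous_on S f"
  by (cases k)
     (auto intro!: continuous_at_imp_continuous_on differentiable_imp_continuous_within)

lemma Ck_on_SucD: "Ck_on (Suc k) S f \<Longrightarrow> Ck_on k S f"
proof (induction k arbitrary: f)
  case 0
  then show ?case using Ck_on_continuous by (metis Ck_on.simps(1))
next
  case (Suc k)
  then show ?case by (metis Ck_on.simps(2))
qed

lemma Ck_on_differentiable: "Ck_on (Suc k) S f \<Longrightarrow> x \<in> S \<Longrightarrow> f differentiable (at x)"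
  by simp

lemma Ck_on_dd: "Ck_on (Suc k) S f \<Longrightarrow> Ck_on k S (\<lambda>x. dd f x v)"
  by simp

lemma Ck_on_const: "Ck_on k S (\<lambda>x. c)"
proof (induction k arbitrary: c)
  case (Suc k)
  then show ?case by (simp add: fun_eq_iff)
qed simp

section \<open>Algebraic operations on C^k maps\<close>

lemma Ck_on_linear:
  fixes f :: "'a::euclidean_space \<Rightarrow> 'b::euclidean_space" and h :: "'b \<Rightarrow> 'c::euclidean_space"
  assumes "open S" "linear h" "Ck_on k S f"
  shows "Ck_on k S (\<lambda>x. h (f x))"
  using assms(3)
proof (induction k arbitrary: f)
  case 0
  then show ?case
    using assms(2) by (simp add: linear_continuous_on_compose)
next
  case (Suc k)
  have bl: "bounded_linear h" using assms(2) by (simp add: linear_conv_bounded_linear)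
  have d: "((\<lambda>x. h (f x)) has_derivative (\<lambda>v. h (dd f x v))) (at x)" if "x \<in> S" for x
    by (rule bounded_linear.has_derivative[OF bl has_derivative_dd]) (use Suc.prems that in simp)
  have "Ck_on k S (\<lambda>x. dd (\<lambda>x. h (f x)) x v)" for v
    by (rule Ck_on_cong_imp[OF assms(1) _ Suc.IH[of "\<lambda>x. dd f x v"]])
       (use dd_eq[OF d] Suc.prems in auto)
  with d show ?case by (auto simp: differentiable_def)
qed

lemma Ck_on_add:
  assumes "open S" "Ck_on k S f" "Ck_on k S g"
  shows "Ck_on k S (\<lambda>x. f x + g x)"
  using assms(2,3)
proof (induction k arbitrary: f g)
  case 0
  then show ?case by (simp add: continuous_on_add)
next
  case (Suc k)
  have d: "((\<lambda>x. f x + g x) has_derivative (\<lambda>v. dd f x v + dd g x v)) (at x)" if "x \<in> S" for x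
    using Suc.prems that by (intro has_derivative_add has_derivative_dd) auto
  have "Ck_on k S (\<lambda>x. dd (\<lambda>x. f x + g x) x v)" for v
    by (rule Ck_on_cong_imp[OF assms(1) _ Suc.IH[of "\<lambda>x. dd f x v" "\<lambda>x. dd g x v"]])
       (use dd_eq[OF d] Suc.prems in auto)
  with d show ?case by (auto simp: differentiable_def)
qed

lemma Ck_on_minus: "open S \<Longrightarrow> Ck_on k S f \<Longrightarrow> Ck_on k S (\<lambda>x. - f x)"
  by (rule Ck_on_linear) (auto intro: linearI)

lemma Ck_on_diff:
  assumes "open S" "Ck_on k S f" "Ck_on k S g"
  shows "Ck_on k S (\<lambda>x. f x - g x)"
  using Ck_on_add[OF assms(1,2) Ck_on_minus[OF assms(1,3)]] by simp

lemma Ck_on_sum: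
  assumes "open S" "\<And>i. i \<in> I \<Longrightarrow> Ck_on k S (f i)"
  shows "Ck_on k S (\<lambda>x. \<Sum>i\<in>I. f i x)"
  using assms(2)
  by (induction I rule: infinite_finite_induct) (auto intro!: Ck_on_const Ck_on_add assms(1))

lemma Ck_on_bilinear:
  fixes f :: "'a::euclidean_space \<Rightarrow> 'b::euclidean_space" and g :: "'a \<Rightarrow> 'c::euclidean_space"
    and h :: "'b \<Rightarrow> 'c \<Rightarrow> 'e::euclidean_space"
  assumes "open S" "bounded_bilinear h" "Ck_on k S f" "Ck_on k S g"
  shows "Ck_on k S (\<lambda>x. h (f x) (g x))"
  using assms(3,4)
proof (induction k arbitrary: f g)
  case 0
  then show ?case by (simp add: bounded_bilinear.continuous_on[OF assms(2)])
next
  case (Suc k)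
  have d: "((\<lambda>x. h (f x) (g x)) has_derivative (\<lambda>v. h (f x) (dd g x v) + h (dd f x v) (g x))) (at x)"
    if "x \<in> S" for x
    using Suc.prems that by (intro bounded_bilinear.FDERIV[OF assms(2)] has_derivative_dd) auto
  have fg: "Ck_on k S f" "Ck_on k S g" using Suc.prems by (auto intro: Ck_on_SucD)
  have "Ck_on k S (\<lambda>x. dd (\<lambda>x. h (f x) (g x)) x v)" for v
    by (rule Ck_on_cong_imp[OF assms(1) _
          Ck_on_add[OF assms(1) Suc.IH[of f "\<lambda>x. dd g x v"] Suc.IH[of "\<lambda>x. dd f x v" g]]])
       (use dd_eq[OF d] Suc.prems fg in auto)
  with d show ?case by (auto simp: differentiable_def)
qed

lemmas Ck_on_mult = Ck_on_bilinear[OF _ bounded_bilinear_mult]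
lemmas Ck_on_scaleR = Ck_on_bilinear[OF _ bounded_bilinear_scaleR]
lemmas Ck_on_inner = Ck_on_bilinear[OF _ bounded_bilinear_inner]

lemma Ck_on_prod:
  fixes f :: "'i \<Rightarrow> 'a::euclidean_space \<Rightarrow> real"
  assumes "open S" "\<And>i. i \<in> I \<Longrightarrow> Ck_on k S (f i)"
  shows "Ck_on k S (\<lambda>x. \<Prod>i\<in>I. f i x)"
  using assms(2)
  by (induction I rule: infinite_finite_induct) (auto intro!: Ck_on_const Ck_on_mult assms(1))

text \<open>The derivative of 1/f contains 1/f again, so f stays fixed in the induction and the
  hypothesis for k supplies the regularity of that factor.\<close>

lemma Ck_on_inverse:
  fixes f :: "'a::euclidean_space \<Rightarrow> real"
  assumes "open S" "\<And>x. x \<in> S \<Longrightarrow> f x \<noteq> 0" "Ck_on k S f"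
  shows "Ck_on k S (\<lambda>x. inverse (f x))"
  using assms(3)
proof (induction k)
  case 0
  then show ?case using assms(2) by (simp add: continuous_on_inverse)
next
  case (Suc k)
  have d: "((\<lambda>x. inverse (f x)) has_derivative (\<lambda>v. - (inverse (f x) * dd f x v * inverse (f x)))) (at x)"
    if "x \<in> S" for x
    by (rule Deriv.has_derivative_inverse[where f=f]) (use Suc.prems that assms(2) has_derivative_dd in auto)
  have i: "Ck_on k S (\<lambda>x. inverse (f x))" using Suc Ck_on_SucD by blast
  have "Ck_on k S (\<lambda>x. - (inverse (f x) * dd f x v * inverse (f x)))" for v
    using Suc.prems by (intro Ck_on_minus Ck_on_mult assms(1) i) simp
  then have "Ck_on k S (\<lambda>x. dd (\<lambda>x. inverse (f x)) x v)" for v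
    by (rule Ck_on_cong_imp[OF assms(1), rotated]) (rule dd_eq[OF d, symmetric])
  with d show ?case by (auto simp: differentiable_def)
qed

lemma Ck_on_divide:
  fixes f g :: "'a::euclidean_space \<Rightarrow> real"
  assumes "open S" "\<And>x. x \<in> S \<Longrightarrow> g x \<noteq> 0" "Ck_on k S f" "Ck_on k S g"
  shows "Ck_on k S (\<lambda>x. f x / g x)"
  using Ck_on_mult[OF assms(1,3) Ck_on_inverse[OF assms(1,2,4)]] by (simp add: divide_inverse)

section \<open>Vector- and matrix-valued maps\<close>

lemma linear_vec_nth: "linear (\<lambda>x::'a::real_vector^'n. x $ i)"
  by (rule linearI) auto

lemma linear_axis: "linear (axis i :: 'a::real_vector \<Rightarrow> 'a^'n)"
  by (rule linearI) (auto simp: axis_def vec_eq_iff)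

lemma vec_lambda_as_sum: "(\<chi> i. z i) = (\<Sum>i\<in>UNIV. axis i (z i))"
  by (auto simp: vec_eq_iff axis_def sum.delta)

lemma Ck_on_vec_nth:
  fixes f :: "'a::euclidean_space \<Rightarrow> 'b::euclidean_space^'n"
  shows "open S \<Longrightarrow> Ck_on k S f \<Longrightarrow> Ck_on k S (\<lambda>x. f x $ i)"
  by (rule Ck_on_linear[OF _ linear_vec_nth])

lemma Ck_on_vec_lambda:
  fixes f :: "'n::finite \<Rightarrow> 'a::euclidean_space \<Rightarrow> 'b::euclidean_space"
  assumes "open S" "\<And>i. Ck_on k S (f i)"
  shows "Ck_on k S (\<lambda>x. \<chi> i. f i x)"
  unfolding vec_lambda_as_sum
  by (intro Ck_on_sum assms(1) Ck_on_linear[OF _ linear_axis] assms(2))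

lemma Ck_on_det:
  fixes A :: "'a::euclidean_space \<Rightarrow> real^'n^'n"
  assumes "open S" "\<And>i j. Ck_on k S (\<lambda>x. A x $ i $ j)"
  shows "Ck_on k S (\<lambda>x. det (A x))"
  unfolding det_def
  by (intro Ck_on_sum Ck_on_mult Ck_on_prod assms Ck_on_const)

lemma matrix_inv_both:
  assumes "invertible A"
  shows "A ** matrix_inv A = mat 1" "matrix_inv A ** A = mat 1"
  using someI_ex[of "\<lambda>B. A ** B = mat 1 \<and> B ** A = mat 1"] assms
  by (auto simp: matrix_inv_def invertible_def)

text \<open>Cramer's rule, applied to the columns of the identity. It exhibits the inverse as a
  rational expression in the entries, which is how smoothness passes from the metric to its
  inverse.\<close>

lemma matrix_inv_nth:
  fixes A :: "real^'n^'n"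
  assumes "det A \<noteq> 0"
  shows "matrix_inv A $ k $ j = det (\<chi> a b. if b = k then axis j 1 $ a else A $ a $ b) / det A"
proof -
  have inv: "invertible A" using assms invertible_det_nz by blast
  have "A *v (matrix_inv A *v axis j 1) = axis j 1"
    using inv by (simp add: matrix_vector_mul_assoc matrix_inv_both)
  then have "matrix_inv A *v axis j 1 =
      (\<chi> k. det (\<chi> a b. if b = k then axis j 1 $ a else A $ a $ b) / det A)"
    using cramer[OF assms] by blast
  moreover have "matrix_inv A *v axis j 1 = column j (matrix_inv A)"
    by (simp add: matrix_vector_mult_basis)
  ultimately show ?thesis
    by (metis (no_types, lifting) column_def vec_lambda_beta)
qed

lemma Ck_on_matrix_inv:
  fixes A :: "'a::euclidean_space \<Rightarrow> real^'n^'n"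
  assumes "open S" "\<And>x. x \<in> S \<Longrightarrow> invertible (A x)" "Ck_on k S A"
  shows "Ck_on k S (\<lambda>x. matrix_inv (A x))"
proof -
  have nz: "det (A x) \<noteq> 0" if "x \<in> S" for x
    using assms(2) that invertible_det_nz by blast
  have ent: "Ck_on k S (\<lambda>x. A x $ i $ j)" for i j
    by (intro Ck_on_vec_nth assms)
  have ent': "Ck_on k S (\<lambda>x. (\<chi> a b. if b = i then axis j 1 $ a else A x $ a $ b) $ p $ q)" for i j p q
    by (cases "q = i") (simp_all add: ent Ck_on_const)
  have "Ck_on k S (\<lambda>x. \<chi> i j. det (\<chi> a b. if b = i then axis j 1 $ a else A x $ a $ b) / det (A x))"
    by (intro Ck_on_vec_lambda Ck_on_divide Ck_on_det assms(1) ent nz ent')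

  then show ?thesis
    by (rule Ck_on_cong_imp[OF assms(1), rotated]) (simp add: vec_eq_iff matrix_inv_nth nz)
qed

section \<open>Linear maps depending on a point, evaluated at a vector field\<close>

lemma linear_dd: "f differentiable (at x) \<Longrightarrow> linear (dd f x)"
  by (rule linear_frechet_derivative)

lemma linear_expand_Basis:
  fixes h :: "'a::euclidean_space \<Rightarrow> 'b::real_vector"
  assumes "linear h"
  shows "h v = (\<Sum>i\<in>Basis. (v \<bullet> i) *\<^sub>R h i)"
proof -
  have "h v = h (\<Sum>i\<in>Basis. (v \<bullet> i) *\<^sub>R i)" by (simp add: euclidean_representation)
  then show ?thesis by (simp add: linear_sum[OF assms] linear_scale[OF assms])
qed

text \<open>Expanding the argument in the fixed basis turns regularity for constant arguments into
  regularity for variable ones. Multilinear objects such as \<open>Gam\<close> and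
  \<open>Riem\<close> are treated one slot at a time.\<close>

lemma Ck_on_linear_family:
  fixes L :: "'a::euclidean_space \<Rightarrow> 'b::euclidean_space \<Rightarrow> 'c::euclidean_space"
  assumes "open S" "\<And>x. x \<in> S \<Longrightarrow> linear (L x)" "\<And>u. Ck_on k S (\<lambda>x. L x u)" "Ck_on k S X"
  shows "Ck_on k S (\<lambda>x. L x (X x))"
proof -
  have "Ck_on k S (\<lambda>x. \<Sum>i\<in>Basis. (X x \<bullet> i) *\<^sub>R L x i)"
    by (intro Ck_on_sum Ck_on_scaleR Ck_on_inner Ck_on_const assms(1,3,4))
  then show ?thesis
    by (rule Ck_on_cong_imp[OF assms(1), rotated]) (metis assms(2) linear_expand_Basis)
qed

text \<open>The product rule for evaluation. Differentiability of L is assumed only for each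
  constant argument; the basis expansion reduces the claim to finitely many products of a scalar and
  a vector.\<close>

lemma has_derivative_linear_family:
  fixes L :: "'a::real_normed_vector \<Rightarrow> 'b::euclidean_space \<Rightarrow> 'c::real_normed_vector"
  assumes S: "open S" "x \<in> S" and lin: "\<And>y. y \<in> S \<Longrightarrow> linear (L y)"
    and dL: "\<And>u. (\<lambda>y. L y u) differentiable (at x)" and dX: "X differentiable (at x)"
  shows "((\<lambda>y. L y (X y)) has_derivative (\<lambda>v. dd (\<lambda>y. L y (X x)) x v + L x (dd X x v))) (at x)"
proof -
  have e: "L y u = (\<Sum>i\<in>Basis. (u \<bullet> i) *\<^sub>R L y i)" if "y \<in> S" for y u
    using linear_expand_Basis[OF lin[OF that]] .
  have "((\<lambda>y. \<Sum>i\<in>Basis. (X x \<bullet> i) *\<^sub>R L y i) has_derivative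
      (\<lambda>v. \<Sum>i\<in>Basis. (X x \<bullet> i) *\<^sub>R dd (\<lambda>y. L y i) x v)) (at x)"
    by (intro has_derivative_sum has_derivative_scaleR_right has_derivative_dd dL)
  then have 1: "((\<lambda>y. L y (X x)) has_derivative
      (\<lambda>v. \<Sum>i\<in>Basis. (X x \<bullet> i) *\<^sub>R dd (\<lambda>y. L y i) x v)) (at x)"
    by (rule has_derivative_transform_within_open[OF _ S]) (simp add: e[symmetric])
  have "((\<lambda>y. \<Sum>i\<in>Basis. (X y \<bullet> i) *\<^sub>R L y i) has_derivative
      (\<lambda>v. \<Sum>i\<in>Basis. (X x \<bullet> i) *\<^sub>R dd (\<lambda>y. L y i) x v + (dd X x v \<bullet> i) *\<^sub>R L x i)) (at x)"
    by (intro has_derivative_sum has_derivative_scaleR has_derivative_dd has_derivative_inner_left dL dX)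
  then have "((\<lambda>y. L y (X y)) has_derivative
      (\<lambda>v. \<Sum>i\<in>Basis. (X x \<bullet> i) *\<^sub>R dd (\<lambda>y. L y i) x v + (dd X x v \<bullet> i) *\<^sub>R L x i)) (at x)"
    by (rule has_derivative_transform_within_open[OF _ S]) (simp add: e[symmetric])
  then show ?thesis
    by (simp add: sum.distrib dd_eq[OF 1] e[OF S(2), symmetric])
qed

lemma dd_linear_family:
  fixes L :: "'a::real_normed_vector \<Rightarrow> 'b::euclidean_space \<Rightarrow> 'c::real_normed_vector"
  assumes "open S" "x \<in> S" "\<And>y. y \<in> S \<Longrightarrow> linear (L y)"
    "\<And>u. (\<lambda>y. L y u) differentiable (at x)" "X differentiable (at x)"
  shows "dd (\<lambda>y. L y (X y)) x v = dd (\<lambda>y. L y (X x)) x v + L x (dd X x v)"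
  by (rule dd_eq[OF has_derivative_linear_family[OF assms]])

lemma differentiable_linear_family:
  fixes L :: "'a::real_normed_vector \<Rightarrow> 'b::euclidean_space \<Rightarrow> 'c::real_normed_vector"
  assumes "open S" "x \<in> S" "\<And>y. y \<in> S \<Longrightarrow> linear (L y)"
    "\<And>u. (\<lambda>y. L y u) differentiable (at x)" "X differentiable (at x)"
  shows "(\<lambda>y. L y (X y)) differentiable (at x)"
  using has_derivative_linear_family[OF assms] by (auto simp: differentiable_def)

lemma dd_add:
  assumes "f differentiable (at x)" "g differentiable (at x)"
  shows "dd (\<lambda>y. f y + g y) x v = dd f x v + dd g x v"
  by (rule dd_eq) (intro has_derivative_add has_derivative_dd assms)

lemma dd_diff:
  assumes "f differentiable (at x)" "g differentiable (at x)"
  shows "dd (\<lambda>y. f y - g y) x v = dd f x v - dd g x v"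
  by (rule dd_eq) (intro has_derivative_diff has_derivative_dd assms)

lemma dd_linear:
  fixes h :: "'b::euclidean_space \<Rightarrow> 'c::real_normed_vector"
  assumes "linear h" "f differentiable (at x)"
  shows "dd (\<lambda>y. h (f y)) x v = h (dd f x v)"
  using bounded_linear.has_derivative[of h, OF _ has_derivative_dd[OF assms(2)]] assms(1)
  by (auto simp: linear_conv_bounded_linear dd_eq)

lemma dd_bilinear:
  assumes "bounded_bilinear h" "f differentiable (at x)" "g differentiable (at x)"
  shows "dd (\<lambda>y. h (f y) (g y)) x v = h (f x) (dd g x v) + h (dd f x v) (g x)"
  by (rule dd_eq) (intro bounded_bilinear.FDERIV[OF assms(1)] has_derivative_dd assms(2,3))

section \<open>Symmetry of second derivatives\<close>

lemma has_real_derivative_along_line: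
  fixes f :: "'a::euclidean_space \<Rightarrow> real"
  assumes "f differentiable (at (a + s *\<^sub>R u))"
  shows "((\<lambda>s. f (a + s *\<^sub>R u)) has_real_derivative dd f (a + s *\<^sub>R u) u) (at s)"
proof -
  have "((\<lambda>s. a + s *\<^sub>R u) has_derivative (\<lambda>h. h *\<^sub>R u)) (at s)"
    by (auto intro!: derivative_eq_intros)
  then have "((\<lambda>s. f (a + s *\<^sub>R u)) has_derivative (\<lambda>h. dd f (a + s *\<^sub>R u) (h *\<^sub>R u))) (at s)"
    by (rule has_derivative_compose[where g=f]) (rule has_derivative_dd[OF assms])
  then show ?thesis
    by (simp add: has_field_derivative_def linear_scale[OF linear_dd[OF assms]] mult.commute[of _ "dd f (a + s *\<^sub>R u) u"])
qed

text \<open>Two applications of the mean value theorem to a second-order difference quotient.\<close>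

lemma second_difference_mean_value:
  fixes f :: "'a::euclidean_space \<Rightarrow> real"
  assumes f: "Ck_on 2 S f" and h: "h > 0"
    and sub: "\<And>s t. 0 \<le> s \<Longrightarrow> s \<le> h \<Longrightarrow> 0 \<le> t \<Longrightarrow> t \<le> h \<Longrightarrow> x + s *\<^sub>R u + t *\<^sub>R v \<in> S"
  shows "\<exists>s t. 0 < s \<and> s < h \<and> 0 < t \<and> t < h \<and>
    f (x + h *\<^sub>R u + h *\<^sub>R v) - f (x + h *\<^sub>R u) - f (x + h *\<^sub>R v) + f x =
    h * h * dd (\<lambda>y. dd f y u) (x + s *\<^sub>R u + t *\<^sub>R v) v"
proof -
  have d1: "f differentiable (at y)" if "y \<in> S" for y
    using f that by (simp add: numeral_2_eq_2)
  have d2: "(\<lambda>y. dd f y u) differentiable (at y)" if "y \<in> S" for y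
    using f that by (simp add: numeral_2_eq_2)
  define p where "p s = f (x + h *\<^sub>R v + s *\<^sub>R u) - f (x + s *\<^sub>R u)" for s
  have "\<exists>s. 0 < s \<and> s < h \<and>
      p h - p 0 = (h - 0) * (dd f (x + h *\<^sub>R v + s *\<^sub>R u) u - dd f (x + s *\<^sub>R u) u)"
  proof (rule MVT2[OF h])
    fix s assume s: "0 \<le> s" "s \<le> h"
    show "(p has_real_derivative dd f (x + h *\<^sub>R v + s *\<^sub>R u) u - dd f (x + s *\<^sub>R u) u) (at s)"
      unfolding p_def
      by (intro DERIV_diff has_real_derivative_along_line d1)
         (use sub[of s h] sub[of s 0] s h in \<open>auto simp: algebra_simps\<close>)
  qed
  then obtain s where s: "0 < s" "s < h"
    "p h - p 0 = h * (dd f (x + h *\<^sub>R v + s *\<^sub>R u) u - dd f (x + s *\<^sub>R u) u)" by auto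
  define q where "q t = dd f (x + s *\<^sub>R u + t *\<^sub>R v) u" for t
  have "\<exists>t. 0 < t \<and> t < h \<and>
      q h - q 0 = (h - 0) * dd (\<lambda>y. dd f y u) (x + s *\<^sub>R u + t *\<^sub>R v) v"
  proof (rule MVT2[OF h])
    fix t assume "0 \<le> t" "t \<le> h"
    then show "(q has_real_derivative dd (\<lambda>y. dd f y u) (x + s *\<^sub>R u + t *\<^sub>R v) v) (at t)"
      unfolding q_def
      by (intro has_real_derivative_along_line d2 sub) (use s in auto)
  qed
  then obtain t where t: "0 < t" "t < h"
    "q h - q 0 = h * dd (\<lambda>y. dd f y u) (x + s *\<^sub>R u + t *\<^sub>R v) v" by auto
  have "p h - p 0 = h * (q h - q 0)"
    using s(3) by (simp add: q_def algebra_simps)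
  then have "p h - p 0 = h * h * dd (\<lambda>y. dd f y u) (x + s *\<^sub>R u + t *\<^sub>R v) v"
    using t(3) by simp
  then show ?thesis using s t by (intro exI[of _ s] exI[of _ t]) (simp add: p_def algebra_simps)
qed

text \<open>The second-order difference over a parallelogram is symmetric in u and v. Expressed by
  mean values in both orders, it equates the two mixed derivatives at two points arbitrarily close
  to x, and continuity does the rest.\<close>

lemma dd_dd_commute_real:
  fixes f :: "'a::euclidean_space \<Rightarrow> real"
  assumes S: "open S" "x \<in> S" and f: "Ck_on 2 S f"
  shows "dd (\<lambda>y. dd f y u) x v = dd (\<lambda>y. dd f y v) x u"
proof -
  define A where "A y = dd (\<lambda>y. dd f y u) y v" for y
  define B where "B y = dd (\<lambda>y. dd f y v) y u" for y
  have contA: "isCont A x" and contB: "isCont B x"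
    using f S unfolding A_def B_def by (auto simp: numeral_2_eq_2 continuous_on_eq_continuous_at)
  show ?thesis
  proof (rule ccontr)
    assume "\<not> ?thesis"
    \<comment> \<open>With half the gap as tolerance, the values of A and B near x lie in disjoint
      intervals.\<close>
    then have e: "\<bar>A x - B x\<bar> / 2 > 0" (is "?e > 0") by (simp add: A_def B_def)
    obtain d1 where d1: "d1 > 0" "\<And>y. dist y x < d1 \<Longrightarrow> \<bar>A y - A x\<bar> < ?e"
      using contA e unfolding continuous_at_eps_delta dist_real_def by metis
    obtain d2 where d2: "d2 > 0" "\<And>y. dist y x < d2 \<Longrightarrow> \<bar>B y - B x\<bar> < ?e"
      using contB e unfolding continuous_at_eps_delta dist_real_def by metis
    obtain d3 where d3: "d3 > 0" "\<And>y. dist y x < d3 \<Longrightarrow> y \<in> S"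
      using S by (metis open_dist)
    define d where "d = min d1 (min d2 d3)"
    have d: "d > 0" using d1 d2 d3 by (simp add: d_def)
    \<comment> \<open>The parallelogram with sides h u and h v then has all its points within d/2 of
      x; the summand 1 keeps the denominator positive when u = v = 0.\<close>
    define h where "h = d / (2 * (norm u + norm v + 1))"
    have n: "norm u + norm v + 1 > 0" by (simp add: add_nonneg_pos)
    have h: "h > 0" using d n by (simp add: h_def)
    have hn: "h * (norm u + norm v + 1) = d / 2" unfolding h_def using n by (simp add: divide_simps)
    have near: "dist (x + s *\<^sub>R u + t *\<^sub>R v) x < d" if "0 \<le> s" "s \<le> h" "0 \<le> t" "t \<le> h" for s t
    proof -
      have "dist (x + s *\<^sub>R u + t *\<^sub>R v) x = norm (s *\<^sub>R u + t *\<^sub>R v)"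
        by (simp add: dist_norm algebra_simps)
      also have "\<dots> \<le> s * norm u + t * norm v"
        using norm_triangle_ineq[of "s *\<^sub>R u" "t *\<^sub>R v"] that by simp
      also have "\<dots> \<le> h * norm u + h * norm v"
        using that by (intro add_mono mult_right_mono) auto
      also have "\<dots> < d" using hn h d by (simp add: algebra_simps)
      finally show ?thesis .
    qed
    obtain s t where st: "0 < s" "s < h" "0 < t" "t < h"
      "f (x + h *\<^sub>R u + h *\<^sub>R v) - f (x + h *\<^sub>R u) - f (x + h *\<^sub>R v) + f x = h * h * A (x + s *\<^sub>R u + t *\<^sub>R v)"
      using second_difference_mean_value[OF f h, of x u v] near d3 by (force simp: d_def A_def)
    have near': "dist (x + s *\<^sub>R v + t *\<^sub>R u) x < d" if "0 \<le> s" "s \<le> h" "0 \<le> t" "t \<le> h" for s t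
      using near[OF that(3,4,1,2)] by (simp add: algebra_simps)
    obtain s' t' where st': "0 < s'" "s' < h" "0 < t'" "t' < h"
      "f (x + h *\<^sub>R v + h *\<^sub>R u) - f (x + h *\<^sub>R v) - f (x + h *\<^sub>R u) + f x = h * h * B (x + s' *\<^sub>R v + t' *\<^sub>R u)"
      using second_difference_mean_value[OF f h, of x v u] near' d3 by (force simp: d_def B_def)
    have "h * h * A (x + s *\<^sub>R u + t *\<^sub>R v) = h * h * B (x + s' *\<^sub>R v + t' *\<^sub>R u)"
      using st(5) st'(5) by (simp add: algebra_simps)
    then have "A (x + s *\<^sub>R u + t *\<^sub>R v) = B (x + s' *\<^sub>R v + t' *\<^sub>R u)" using h by simp
    moreover have "\<bar>A (x + s *\<^sub>R u + t *\<^sub>R v) - A x\<bar> < ?e"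
      using d1(2) near[of s t] st by (simp add: d_def)
    moreover have "\<bar>B (x + s' *\<^sub>R v + t' *\<^sub>R u) - B x\<bar> < ?e"
      using d2(2) near'[of s' t'] st' by (simp add: d_def)
    ultimately show False by (simp add: abs_if split: if_splits)
  qed
qed

lemma dd_dd_commute:
  fixes f :: "'a::euclidean_space \<Rightarrow> 'b::euclidean_space"
  assumes S: "open S" "x \<in> S" and f: "Ck_on 2 S f"
  shows "dd (\<lambda>y. dd f y u) x v = dd (\<lambda>y. dd f y v) x u"
proof (rule euclidean_eqI)
  fix i :: 'b assume "i \<in> Basis"
  have li: "linear (\<lambda>z::'b. z \<bullet> i)" by (auto intro: linearI simp: inner_add_left)
  have d1: "f differentiable (at y)" "(\<lambda>y. dd f y w) differentiable (at y)" if "y \<in> S" for y w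
    using f that by (simp_all add: numeral_2_eq_2)
  have dli: "(\<lambda>y. dd f y a \<bullet> i) differentiable (at x)" for a
    using bounded_linear.has_derivative[OF bounded_linear_inner_left has_derivative_dd[OF d1(2)[OF S(2)]]]
    by (auto simp: differentiable_def)
  have comp: "dd (\<lambda>y. dd f y a) x b \<bullet> i = dd (\<lambda>y. dd (\<lambda>z. f z \<bullet> i) y a) x b" for a b
  proof -
    have "dd (\<lambda>y. dd (\<lambda>z. f z \<bullet> i) y a) x b = dd (\<lambda>y. dd f y a \<bullet> i) x b"
      by (rule dd_cong[symmetric, OF _ S])
         (use dli dd_linear[OF li d1(1)] in simp_all)
    then show ?thesis using dd_linear[OF li d1(2)[OF S(2)]] by simp
  qed
  show "dd (\<lambda>y. dd f y u) x v \<bullet> i = dd (\<lambda>y. dd f y v) x u \<bullet> i"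
    unfolding comp by (rule dd_dd_commute_real[OF S Ck_on_linear[OF S(1) li f]])
qed

lemma differentiable_bilinear:
  assumes "bounded_bilinear h" "f differentiable (at x)" "g differentiable (at x)"
  shows "(\<lambda>y. h (f y) (g y)) differentiable (at x)"
  using bounded_bilinear.FDERIV[OF assms(1) has_derivative_dd[OF assms(2)] has_derivative_dd[OF assms(3)]]
  by (auto simp: differentiable_def)

section \<open>Operators that are self-adjoint for an inner product\<close>

text \<open>This is \<open>metric_at\<close> with the point already inserted, so that the algebra at
  one point involves a single matrix.\<close>

definition form :: "real^'n^'n \<Rightarrow> real^'n \<Rightarrow> real^'n \<Rightarrow> real" where
  "form G u v = u \<bullet> (G *v v)"

definition inner_matrix :: "real^'n^'n \<Rightarrow> bool" where
  "inner_matrix G \<longleftrightarrow> (\<forall>u v. form G u v = form G v u) \<and> (\<forall>u. u \<noteq> 0 \<longrightarrow> form G u u > 0)"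

definition self_adjoint :: "real^'n^'n \<Rightarrow> real^'n^'n \<Rightarrow> bool" where
  "self_adjoint G M \<longleftrightarrow> (\<forall>u v. form G (M *v u) v = form G u (M *v v))"

definition diag_matrix :: "('n \<Rightarrow> 'a::zero) \<Rightarrow> 'a^'n^'n" where
  "diag_matrix l = (\<chi> i j. if i = j then l i else 0)"

lemma form_simps:
  "form G (u + u') v = form G u v + form G u' v"
  "form G u (v + v') = form G u v + form G u v'"
  "form G (u - u') v = form G u v - form G u' v"
  "form G u (v - v') = form G u v - form G u v'"
  "form G (c *\<^sub>R u) v = c * form G u v"
  "form G u (c *\<^sub>R v) = c * form G u v"
  "form G 0 v = 0" "form G u 0 = 0"
  by (simp_all add: form_def inner_add_left inner_add_right inner_diff_left inner_diff_right
      matrix_vector_right_distrib matrix_vector_mult_diff_distrib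
      matrix_vector_mult_scaleR)

lemma inner_matrixD:
  assumes "inner_matrix G"
  shows "form G u v = form G v u" "u \<noteq> 0 \<Longrightarrow> form G u u > 0" "form G u u \<ge> 0"
    "form G u u = 0 \<longleftrightarrow> u = 0"
proof -
  show s: "form G u v = form G v u" and p: "u \<noteq> 0 \<Longrightarrow> form G u u > 0"
    using assms by (auto simp: inner_matrix_def)
  show "form G u u \<ge> 0" "form G u u = 0 \<longleftrightarrow> u = 0"
    using p by (cases "u = 0"; force simp: form_simps)+
qed

section \<open>The spectral theorem for a general inner product\<close>

lemma continuous_on_form: "continuous_on S (\<lambda>x. form G (M *v x) x)"
proof -
  have "linear (\<lambda>x. M *v x)" for M :: "real^'n^'n" by simp
  note c = linear_continuous_on[OF this[unfolded linear_conv_bounded_linear]]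
  show ?thesis unfolding form_def
    by (intro continuous_on_inner) (use c c[of S "G ** M"] in \<open>auto\<close>)
qed

text \<open>A maximum point of the Rayleigh quotient on an invariant subspace is an eigenvector.\<close>

lemma self_adjoint_eigenvector:
  assumes G: "inner_matrix G" and M: "self_adjoint G M"
    and W: "subspace W" "\<And>x. x \<in> W \<Longrightarrow> M *v x \<in> W" "W \<noteq> {0}"
  shows "\<exists>x\<in>W. x \<noteq> 0 \<and> (\<exists>l. M *v x = l *\<^sub>R x)"
proof -
  define S where "S = W \<inter> sphere 0 1"
  have cS: "compact S" unfolding S_def
    by (intro closed_Int_compact closed_subspace W compact_sphere)
  obtain w where w: "w \<in> W" "w \<noteq> 0" using W subspace_0 by blast
  then have "(1 / norm w) *\<^sub>R w \<in> S" by (simp add: S_def subspace_scale W)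
  then have nS: "S \<noteq> {}" by blast
  have pos: "form G x x > 0" if "x \<in> S" for x
    using that G by (auto simp: S_def intro!: inner_matrixD(2))
  have c2: "continuous_on S (\<lambda>x. form G x x)"
    using continuous_on_form[of S G "mat 1"] by simp
  have "continuous_on S (\<lambda>x. form G (M *v x) x / form G x x)"
    by (intro continuous_on_divide c2 continuous_on_form) (use pos in force)
  from continuous_attains_sup[OF cS nS this] obtain x where x: "x \<in> S"
    and max: "\<And>y. y \<in> S \<Longrightarrow> form G (M *v y) y / form G y y \<le> form G (M *v x) x / form G x x"
    by blast
  define l where "l = form G (M *v x) x / form G x x"
  \<comment> \<open>By maximality q is positive semidefinite on W, and q vanishes at x. Such an x
    pairs to zero with all of W, as in the Cauchy-Schwarz inequality, which says that
    \<open>l *\<^sub>R x - M *v x\<close> is orthogonal to W.\<close>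
  define q where "q u v = l * form G u v - form G (M *v u) v" for u v
  have xW: "x \<in> W" "x \<noteq> 0" using x by (auto simp: S_def)
  have q0: "q x x = 0" using pos[OF x] by (simp add: q_def l_def)
  have qpos: "q y y \<ge> 0" if "y \<in> W" for y
  proof (cases "y = 0")
    case False
    define z where "z = (1 / norm y) *\<^sub>R y"
    have zS: "z \<in> S" using that False by (simp add: z_def S_def subspace_scale W)
    have y: "y = norm y *\<^sub>R z" using False by (simp add: z_def)
    have "q z z \<ge> 0"
      using max[OF zS] pos[OF zS] by (simp add: q_def l_def[symmetric] divide_le_eq)
    moreover have "q y y = norm y * norm y * q z z"
      by (subst (1 2) y) (simp add: q_def form_simps matrix_vector_mult_scaleR algebra_simps)
    ultimately show ?thesis by simp
  qed (simp add: q_def form_simps)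
  have qsym: "q u v = q v u" for u v
    using G M by (metis inner_matrixD(1) q_def self_adjoint_def)
  have qx: "q x y = 0" if y: "y \<in> W" for y
  proof (rule ccontr)
    assume ne: "q x y \<noteq> 0"
    have "q (x + t *\<^sub>R y) (x + t *\<^sub>R y) = q x x + t * q x y + t * q y x + t * t * q y y" for t
      by (simp add: q_def form_simps matrix_vector_mult_scaleR matrix_vector_right_distrib algebra_simps)
    then have expand: "q (x + t *\<^sub>R y) (x + t *\<^sub>R y) = 2 * t * q x y + t * t * q y y" for t
      using q0 qsym[of y x] by simp
    have ge: "2 * t * q x y + t * t * q y y \<ge> 0" for t
      using qpos[of "x + t *\<^sub>R y"] expand[of t] xW y W(1) by (metis subspace_add subspace_scale)
    \<comment> \<open>The quadratic in t has its minimum at - q x y / q y y; adding 1 to the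
      denominator avoids division by zero and still makes the value negative.\<close>
    define t where "t = - q x y / (q y y + 1)"
    have qy: "q y y \<ge> 0" using qpos y by blast
    have "2 * t * q x y + t * t * q y y = - (q x y)\<^sup>2 * (q y y + 2) / (q y y + 1)\<^sup>2"
      unfolding t_def using qy by (simp add: divide_simps power2_eq_square) (simp add: algebra_simps)
    moreover have "(q x y)\<^sup>2 * (q y y + 2) / (q y y + 1)\<^sup>2 > 0" using ne qy by simp
    ultimately show False using ge[of t] by simp
  qed
  define z where "z = l *\<^sub>R x - M *v x"
  have "z \<in> W" using xW W by (auto simp: z_def intro: subspace_diff subspace_scale)
  moreover have "form G z y = q x y" for y by (simp add: q_def z_def form_simps)
  ultimately have "form G z z = 0" using qx[of z] by simp
  then have "z = 0" using inner_matrixD(4)[OF G] by blast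
  then have "M *v x = l *\<^sub>R x" by (simp add: z_def)
  then show ?thesis using xW by blast
qed

text \<open>An eigenvector x in W is split off. Its orthogonal complement inside W is invariant
  because M is self-adjoint, and has smaller dimension because x is not orthogonal to
  itself.\<close>

lemma self_adjoint_eigenvectors_span:
  assumes G: "inner_matrix G" and M: "self_adjoint G M"
    and W: "subspace W" "\<And>x. x \<in> W \<Longrightarrow> M *v x \<in> W"
  shows "W \<subseteq> span {x. \<exists>l. M *v x = l *\<^sub>R x}"
  using W
proof (induction "dim W" arbitrary: W rule: less_induct)
  case less
  let ?E = "{x. \<exists>l. M *v x = l *\<^sub>R x}"
  show ?case
  proof (cases "W = {0}")
    case True
    then show ?thesis by (simp add: span_zero)
  next
    case False
    obtain x l where x: "x \<in> W" "x \<noteq> 0" "M *v x = l *\<^sub>R x"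
      using self_adjoint_eigenvector[OF G M less.prems False] by blast
    have px: "form G x x > 0" by (rule inner_matrixD(2)[OF G x(2)])
    define W' where "W' = {y \<in> W. form G x y = 0}"
    have sub: "subspace W'"
      using less.prems(1) by (auto simp: W'_def subspace_def form_simps)
    have inv: "M *v y \<in> W'" if "y \<in> W'" for y
    proof -
      have "form G x (M *v y) = form G (M *v x) y" using M by (simp add: self_adjoint_def)
      then show ?thesis using that less.prems(2) by (simp add: W'_def x(3) form_simps)
    qed
    have "W' \<subset> W" using x px by (force simp: W'_def)
    then have "dim W' < dim W"
      using dim_psubset[of W' W] sub less.prems(1) by (metis span_eq_iff)
    from less.hyps[OF this sub inv] have IH: "W' \<subseteq> span ?E" by blast
    show ?thesis
    proof
      fix y assume y: "y \<in> W"
      define c where "c = form G x y / form G x x"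
      have "y - c *\<^sub>R x \<in> W'"
        using y x px less.prems(1)
        by (auto simp: W'_def form_simps c_def intro: subspace_diff subspace_scale)
      moreover have "x \<in> span ?E" by (rule span_base) (use x in blast)
      ultimately have "(y - c *\<^sub>R x) + c *\<^sub>R x \<in> span ?E"
        using IH by (intro span_add span_scale) auto
      then show "y \<in> span ?E" by simp
    qed
  qed
qed

text \<open>The columns of P form a basis chosen among the eigenvectors. P is merely invertible,
  which suffices since traces and the characteristic polynomial are invariant under
  conjugation.\<close>

theorem self_adjoint_diagonalizable:
  fixes G M :: "real^'n^'n"
  assumes G: "inner_matrix G" and M: "self_adjoint G M"
  shows "\<exists>(P::real^'n^'n) l. invertible P \<and> M ** P = P ** diag_matrix l"
proof -
  let ?E = "{x. \<exists>l. M *v x = l *\<^sub>R x}"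
  have E: "span ?E = UNIV"
    using self_adjoint_eigenvectors_span[OF G M subspace_UNIV] by auto
  obtain B where B: "B \<subseteq> ?E" "independent B" "?E \<subseteq> span B" "card B = dim ?E"
    by (rule basis_exists[of ?E])
  have spB: "span B = UNIV"
    using span_minimal[OF B(3) subspace_span] E by auto
  have "card B = CARD('n)" using B(4) dim_span[of ?E] unfolding E by simp
  moreover have "finite B" by (rule independent_imp_finite[OF B(2)])
  ultimately obtain h where h: "bij_betw h (UNIV :: 'n set) B"
    using finite_same_card_bij[of "UNIV :: 'n set" B] by (metis finite)
  define P :: "real^'n^'n" where "P = (\<chi> i j. h j $ i)"
  have col: "column j P = h j" for j by (simp add: column_def P_def vec_eq_iff)
  have "columns P = range h" by (auto simp: columns_def col)
  then have "columns P = B" using h by (simp add: bij_betw_def)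
  then have "vec.span (columns P) = UNIV" by (simp only: span_vec_eq[of B] spB)
  then have "\<exists>Q. P ** Q = mat 1" by (rule iffD2[OF matrix_right_invertible_span_columns])
  then have invP: "invertible P" using invertible_right_inverse[of P] by blast
  have "\<exists>l. M *v h j = l *\<^sub>R h j" for j
  proof -
    have "h j \<in> ?E" using B(1) bij_betwE[OF h] by (simp add: subset_eq)
    then show "\<exists>l. M *v h j = l *\<^sub>R h j" by blast
  qed
  then obtain l where l: "\<And>j. M *v h j = l j *\<^sub>R h j" by metis
  have "M ** P = P ** diag_matrix l"
  proof -
    have "(M ** P) $ i $ j = (P ** diag_matrix l) $ i $ j" for i j
    proof -
      have "(M ** P) $ i $ j = (M *v h j) $ i"
        by (simp add: matrix_matrix_mult_def matrix_vector_mult_def P_def)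
      also have "\<dots> = (P ** diag_matrix l) $ i $ j"
        by (simp add: l matrix_matrix_mult_def diag_matrix_def P_def mult_delta_right)
      finally show ?thesis .
    qed
    then show ?thesis by (simp add: vec_eq_iff)
  qed
  with invP show ?thesis by blast
qed

section \<open>Traces and eigenvalues of a diagonalized operator\<close>

lemma matrix_mult_diff:
  fixes A B :: "'a::ring_1^'n^'m"
  shows "(A - B) ** C = A ** C - B ** C" "D ** (A - B) = D ** A - D ** B"
  by (simp_all add: matrix_matrix_mult_def vec_eq_iff left_diff_distrib right_diff_distrib sum_subtractf)

lemma diag_matrix_mult:
  fixes l m :: "'n::finite \<Rightarrow> 'a::semiring_1"
  shows "diag_matrix l ** diag_matrix m = diag_matrix (\<lambda>i. l i * m i)"
  by (auto simp: matrix_matrix_mult_def diag_matrix_def vec_eq_iff mult_delta_left)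

lemma trace_diagonalized:
  fixes M P :: "real^'n^'n"
  assumes "invertible P" "M ** P = P ** diag_matrix l"
  shows "trace M = (\<Sum>i\<in>UNIV. l i)"
proof -
  obtain Q where Q: "P ** Q = mat 1" "Q ** P = mat 1" using assms(1) by (auto simp: invertible_def)
  have "trace M = trace (M ** (P ** Q))" by (simp add: Q)
  also have "\<dots> = trace (P ** (diag_matrix l ** Q))" by (simp add: matrix_mul_assoc assms(2))
  also have "\<dots> = trace (diag_matrix l ** (Q ** P))"
    by (subst trace_mul_sym) (simp add: matrix_mul_assoc)
  finally show ?thesis by (simp add: Q trace_def diag_matrix_def)
qed

lemma diagonalized_mult:
  fixes M N P :: "real^'n^'n"
  assumes "M ** P = P ** diag_matrix l" "N ** P = P ** diag_matrix m"
  shows "(M ** N) ** P = P ** diag_matrix (\<lambda>i. l i * m i)"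
  by (metis assms diag_matrix_mult matrix_mul_assoc)

text \<open>The determinant defining \<open>charpoly\<close> lives over the polynomial ring, so the
  conjugation is carried out there: \<open>cm\<close> embeds real matrices multiplicatively, X is
  central, and the nonzero factor \<open>det (cm P)\<close> is cancelled. The characteristic
  polynomial then splits into real linear factors, so its real roots are all of its roots.\<close>

lemma eigenvalues_diagonalized:
  fixes M P :: "real^'n^'n"
  assumes "invertible P" "M ** P = P ** diag_matrix l"
  shows "eigenvalues M = image_mset l (mset_set UNIV)"
proof -
  define cm :: "real^'n^'n \<Rightarrow> real poly^'n^'n" where "cm A = (\<chi> i j. [:A $ i $ j:])" for A
  have cpoly: "(\<Sum>k\<in>K. [:f k:]) = [:\<Sum>k\<in>K. f k:]" for f :: "'n \<Rightarrow> real" and K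
    by (induction K rule: infinite_finite_induct) auto
  have cm_mult: "cm A ** cm B = cm (A ** B)" for A B
    by (simp add: cm_def matrix_matrix_mult_def vec_eq_iff cpoly mult.commute)
  have cm_1: "cm (mat 1) = mat 1" by (simp add: cm_def mat_def vec_eq_iff)
  define X :: "real poly^'n^'n" where "X = diag_matrix (\<lambda>_. [:0, 1:])"
  have XB: "X ** B = B ** X" for B
    by (simp add: X_def matrix_matrix_mult_def diag_matrix_def vec_eq_iff mult_delta_left mult_delta_right)
  have ch: "charpoly A = det (X - cm A)" for A
    unfolding charpoly_def by (rule arg_cong[of _ _ det]) (simp add: X_def cm_def diag_matrix_def vec_eq_iff)
  obtain Q where Q: "P ** Q = mat 1" using assms(1) by (auto simp: invertible_def)
  have "det (cm P) * det (cm Q) = 1"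
    by (metis det_mul cm_mult Q cm_1 det_I)
  then have nz: "det (cm P) \<noteq> 0" by auto
  have "(X - cm M) ** cm P = cm P ** (X - cm (diag_matrix l))"
    by (simp add: matrix_mult_diff cm_mult assms(2) XB)
  then have "charpoly M * det (cm P) = det (cm P) * charpoly (diag_matrix l)"
    unfolding ch by (metis det_mul)
  then have "charpoly M = charpoly (diag_matrix l)" using nz by simp
  also have "\<dots> = (\<Prod>i\<in>UNIV. [:- l i, 1:])"
    unfolding ch
    by (subst det_diagonal) (auto simp: X_def cm_def diag_matrix_def)
  finally have "eigenvalues M = (\<Sum>i\<in>UNIV. {#l i#})"
    unfolding eigenvalues_def by (simp add: proots_prod)
  also have "\<dots> = image_mset l (mset_set UNIV)"
  proof -
    have "(\<Sum>i\<in>I. {#l i#}) = image_mset l (mset_set I)" if "finite I" for I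
      using that by induction auto
    then show ?thesis by simp
  qed
  finally show ?thesis .
qed

section \<open>Elementary symmetric polynomials and power sums\<close>

lemma elem_sym_0: "elem_sym 0 xs = 1"
proof -
  have "{I. I \<subseteq> {..<length xs} \<and> card I = 0} = {{}}" by (auto dest: finite_subset)
  then show ?thesis by (simp add: elem_sym_def)
qed

lemma elem_sym_Nil: "elem_sym (Suc k) [] = 0"
  by (simp add: elem_sym_def)

text \<open>The index sets of size k + 1 are split according to whether they contain the last index.
  Appending at the end, rather than in front, leaves the other indices unshifted.\<close>

lemma elem_sym_snoc:
  "elem_sym (Suc k) (xs @ [x]) = elem_sym (Suc k) xs + x * elem_sym k xs"
proof -
  let ?n = "length xs"
  let ?f = "\<lambda>I. \<Prod>j\<in>I. (xs @ [x]) ! j"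
  let ?S = "\<lambda>k. {I. I \<subseteq> {..<?n} \<and> card I = k}"
  have fin: "finite I" if "I \<subseteq> {..<?n}" for I using that finite_subset by blast
  have split: "{I. I \<subseteq> {..<Suc ?n} \<and> card I = Suc k} = ?S (Suc k) \<union> insert ?n ` ?S k" (is "?L = ?R")
  proof
    show "?L \<subseteq> ?R"
    proof
      fix I assume I: "I \<in> ?L"
      show "I \<in> ?R"
      proof (cases "?n \<in> I")
        case True
        have "finite I" using I finite_subset by blast
        then have "card (I - {?n}) = k" using I True by simp
        moreover have "I - {?n} \<subseteq> {..<?n}" using I by fastforce
        ultimately have "I - {?n} \<in> ?S k" by blast
        then have "insert ?n (I - {?n}) \<in> insert ?n ` ?S k" by (rule imageI)
        then show ?thesis using True by (simp add: insert_absorb)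
      next
        case False
        have "I \<subseteq> {..<?n}" using I False less_Suc_eq by fastforce
        then show ?thesis using I by blast
      qed
    qed
    show "?R \<subseteq> ?L"
    proof
      fix I assume "I \<in> ?R"
      then consider "I \<in> ?S (Suc k)" | J where "J \<in> ?S k" "I = insert ?n J" by blast
      then show "I \<in> ?L"
      proof cases
        case 2
        then have "finite J" "?n \<notin> J" using fin by auto
        then show ?thesis using 2 by (auto simp: less_Suc_eq)
      qed (use less_Suc_eq in auto)
    qed
  qed
  have inj: "inj_on (insert ?n) (?S k)"
  proof (rule inj_onI)
    fix I J assume "I \<in> ?S k" "J \<in> ?S k" "insert ?n I = insert ?n J"
    then have "?n \<notin> I" "?n \<notin> J" "insert ?n I = insert ?n J" by auto
    then show "I = J" using insert_ident by metis
  qed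
  have fn: "finite (?S m)" for m by (rule finite_subset[of _ "Pow {..<?n}"]) auto
  have same: "?f I = (\<Prod>j\<in>I. xs ! j)" if "I \<subseteq> {..<?n}" for I
    using that by (intro prod.cong) (auto simp: nth_append)
  have ins: "?f (insert ?n I) = x * (\<Prod>j\<in>I. xs ! j)" if "I \<subseteq> {..<?n}" for I
    using that fin[OF that] same[OF that] by (subst prod.insert) auto
  have "elem_sym (Suc k) (xs @ [x]) = (\<Sum>I\<in>?S (Suc k) \<union> insert ?n ` ?S k. ?f I)"
    by (simp add: elem_sym_def split[symmetric])
  also have "\<dots> = (\<Sum>I\<in>?S (Suc k). ?f I) + (\<Sum>I\<in>insert ?n ` ?S k. ?f I)"
    by (rule sum.union_disjoint) (use fn in auto)
  also have "\<dots> = (\<Sum>I\<in>?S (Suc k). \<Prod>j\<in>I. xs ! j) + (\<Sum>I\<in>?S k. x * (\<Prod>j\<in>I. xs ! j))"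
    unfolding sum.reindex[OF inj] comp_def
    by (intro arg_cong2[of _ _ _ _ "(+)"] sum.cong refl) (use ins same in auto)
  finally show ?thesis by (simp add: elem_sym_def sum_distrib_left)
qed

text \<open>Appending x changes the k-th polynomial by x times the preceding one, so each identity
  follows by induction on the list from the identity one degree lower. The factors 2, 6, 24 are k!
  and clear denominators.\<close>

lemma Newton_identities:
  fixes xs :: "real list"
  defines "p \<equiv> \<lambda>k. \<Sum>x\<leftarrow>xs. x ^ k"
  shows "elem_sym 1 xs = p 1"
    and "2 * elem_sym 2 xs = p 1 ^ 2 - p 2"
    and "6 * elem_sym 3 xs = p 1 ^ 3 - 3 * p 1 * p 2 + 2 * p 3"
    and "24 * elem_sym 4 xs = p 1 ^ 4 - 6 * p 1 ^ 2 * p 2 + 3 * p 2 ^ 2 + 8 * p 1 * p 3 - 6 * p 4"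
proof -
  have s: "elem_sym 1 (xs @ [x]) = elem_sym 1 xs + x"
    "elem_sym 2 (xs @ [x]) = elem_sym 2 xs + x * elem_sym 1 xs"
    "elem_sym 3 (xs @ [x]) = elem_sym 3 xs + x * elem_sym 2 xs"
    "elem_sym 4 (xs @ [x]) = elem_sym 4 xs + x * elem_sym 3 xs" for x and xs :: "real list"
    using elem_sym_snoc[of 0 xs x] elem_sym_snoc[of 1 xs x] elem_sym_snoc[of 2 xs x] elem_sym_snoc[of 3 xs x]
    by (simp_all add: elem_sym_0 eval_nat_numeral)
  have n: "elem_sym 1 [] = (0::real)" "elem_sym 2 [] = (0::real)" "elem_sym 3 [] = (0::real)" "elem_sym 4 [] = (0::real)"
    using elem_sym_Nil[of 0] elem_sym_Nil[of 1] elem_sym_Nil[of 2] elem_sym_Nil[of 3]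
    by (simp_all add: eval_nat_numeral)
  show e1: "elem_sym 1 xs = p 1"
    unfolding p_def by (induction xs rule: rev_induct) (simp_all only: s n, simp_all)
  have e1: "elem_sym 1 xs = (\<Sum>x\<leftarrow>xs. x ^ 1)" for xs
    by (induction xs rule: rev_induct) (simp_all only: s n, simp_all)
  have e2: "2 * elem_sym 2 xs = (\<Sum>x\<leftarrow>xs. x ^ 1) ^ 2 - (\<Sum>x\<leftarrow>xs. x ^ 2)" for xs
  proof (induction xs rule: rev_induct)
    case (snoc x xs)
    show ?case
      unfolding s distrib_left snoc e1 map_append sum_list_append
      by (simp add: power2_eq_square algebra_simps)
  qed (simp only: n, simp)
  show "2 * elem_sym 2 xs = p 1 ^ 2 - p 2" unfolding p_def by (rule e2)
  have e3: "6 * elem_sym 3 xs = (\<Sum>x\<leftarrow>xs. x ^ 1) ^ 3 - 3 * (\<Sum>x\<leftarrow>xs. x ^ 1) * (\<Sum>x\<leftarrow>xs. x ^ 2)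
      + 2 * (\<Sum>x\<leftarrow>xs. x ^ 3)" for xs
  proof (induction xs rule: rev_induct)
    case (snoc x xs)
    have "6 * elem_sym 3 (xs @ [x]) = 6 * elem_sym 3 xs + 3 * x * (2 * elem_sym 2 xs)"
      unfolding s by (simp add: algebra_simps)
    then show ?case
      unfolding snoc e2 map_append sum_list_append
      by (simp add: power2_eq_square power3_eq_cube algebra_simps)
  qed (simp only: n, simp)
  show "6 * elem_sym 3 xs = p 1 ^ 3 - 3 * p 1 * p 2 + 2 * p 3" unfolding p_def by (rule e3)
  have "24 * elem_sym 4 xs = (\<Sum>x\<leftarrow>xs. x ^ 1) ^ 4 - 6 * (\<Sum>x\<leftarrow>xs. x ^ 1) ^ 2 * (\<Sum>x\<leftarrow>xs. x ^ 2)
      + 3 * (\<Sum>x\<leftarrow>xs. x ^ 2) ^ 2 + 8 * (\<Sum>x\<leftarrow>xs. x ^ 1) * (\<Sum>x\<leftarrow>xs. x ^ 3) - 6 * (\<Sum>x\<leftarrow>xs. x ^ 4)" for xs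
  proof (induction xs rule: rev_induct)
    case (snoc x xs)
    have "24 * elem_sym 4 (xs @ [x]) = 24 * elem_sym 4 xs + 4 * x * (6 * elem_sym 3 xs)"
      unfolding s by (simp add: algebra_simps)
    then show ?case
      unfolding snoc e3 map_append sum_list_append
      by (simp add: power2_eq_square power3_eq_cube power4_eq_xxxx algebra_simps)
  qed (simp only: n, simp)
  then show "24 * elem_sym 4 xs = p 1 ^ 4 - 6 * p 1 ^ 2 * p 2 + 3 * p 2 ^ 2 + 8 * p 1 * p 3 - 6 * p 4"
    unfolding p_def by blast
qed

text \<open>In an eigenbasis the powers of M are diagonal too, so their traces are the power sums of
  the eigenvalues. From here on the sigmas are handled through traces, which can be
  differentiated.\<close>

lemma self_adjoint_sigma_op:
  fixes G M :: "real^'n^'n"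
  assumes "inner_matrix G" "self_adjoint G M"
  shows "sigma_op 1 M = trace M"
    and "2 * sigma_op 2 M = trace M ^ 2 - trace (M ** M)"
    and "6 * sigma_op 3 M = trace M ^ 3 - 3 * trace M * trace (M ** M) + 2 * trace (M ** M ** M)"
    and "24 * sigma_op 4 M = trace M ^ 4 - 6 * trace M ^ 2 * trace (M ** M) + 3 * trace (M ** M) ^ 2
      + 8 * trace M * trace (M ** M ** M) - 6 * trace (M ** M ** M ** M)"
proof -
  obtain P :: "real^'n^'n" and l where P: "invertible P" and l: "M ** P = P ** diag_matrix l"
    using self_adjoint_diagonalizable[OF assms] by blast
  define xs where "xs = sorted_list_of_multiset (eigenvalues M)"
  have "mset xs = image_mset l (mset_set UNIV)"
    by (simp add: xs_def eigenvalues_diagonalized[OF P l])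
  then have "sum_mset (image_mset (\<lambda>x. x ^ k) (mset xs)) = (\<Sum>i\<in>UNIV. l i ^ k)" for k
    by (simp add: sum_unfold_sum_mset image_mset.compositionality comp_def)
  then have "(\<Sum>x\<leftarrow>xs. x ^ k) = (\<Sum>i\<in>UNIV. l i ^ k)" for k
    by (simp add: sum_mset_sum_list[symmetric])
  note N = Newton_identities[of xs, unfolded this]
  note l2 = diagonalized_mult[OF l l]
  note l3 = diagonalized_mult[OF l2 l]
  note l4 = diagonalized_mult[OF l3 l]
  have t: "trace M = (\<Sum>i\<in>UNIV. l i ^ 1)" "trace (M ** M) = (\<Sum>i\<in>UNIV. l i ^ 2)"
    "trace (M ** M ** M) = (\<Sum>i\<in>UNIV. l i ^ 3)" "trace (M ** M ** M ** M) = (\<Sum>i\<in>UNIV. l i ^ 4)"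
    using trace_diagonalized[OF P l] trace_diagonalized[OF P l2] trace_diagonalized[OF P l3]
      trace_diagonalized[OF P l4]
    by (simp_all add: power2_eq_square power3_eq_cube power4_eq_xxxx mult.assoc)
  show "sigma_op 1 M = trace M"
    and "2 * sigma_op 2 M = trace M ^ 2 - trace (M ** M)"
    and "6 * sigma_op 3 M = trace M ^ 3 - 3 * trace M * trace (M ** M) + 2 * trace (M ** M ** M)"
    and "24 * sigma_op 4 M = trace M ^ 4 - 6 * trace M ^ 2 * trace (M ** M) + 3 * trace (M ** M) ^ 2
      + 8 * trace M * trace (M ** M ** M) - 6 * trace (M ** M ** M ** M)"
    unfolding sigma_op_def xs_def[symmetric] t by (fact N)+
qed

section \<open>The Levi-Civita connection and its curvature in a chart\<close>

lemma metric_at_form: "metric_at G x u v = form (G x) u v"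
  by (simp add: metric_at_def form_def)

lemma form_sum: "form A u v = (\<Sum>i\<in>UNIV. \<Sum>j\<in>UNIV. u $ i * A $ i $ j * v $ j)"
  by (simp add: form_def inner_vec_def matrix_vector_mult_def sum_distrib_left mult.assoc)

lemma form_matrix_simps:
  "form (A + B) u v = form A u v + form B u v"
  "form (A - B) u v = form A u v - form B u v"
  "form (c *\<^sub>R A) u v = c * form A u v"
  by (simp_all add: form_sum sum.distrib[symmetric] sum_subtractf[symmetric] sum_distrib_left algebra_simps)

lemma form_nondegenerate:
  assumes "inner_matrix A" "\<And>w. form A u w = form A v w"
  shows "u = v"
proof -
  have "form A (u - v) (u - v) = 0" using assms(2) by (simp add: form_simps)
  then show ?thesis using inner_matrixD(4)[OF assms(1)] by simp
qed

lemma inner_matrix_nth_sym: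
  assumes "inner_matrix A" shows "A $ i $ j = A $ j $ i"
proof -
  have "form A (axis i 1) (axis j 1) = A $ i $ j" for i j
    by (simp add: form_def matrix_vector_mult_basis inner_axis' column_def)
  then show ?thesis using inner_matrixD(1)[OF assms] by metis
qed

lemma inner_matrix_invertible:
  assumes "inner_matrix A" shows "invertible A"
proof -
  have "x = 0" if "A *v x = 0" for x
  proof -
    have "form A x x = 0" using that by (simp only: form_def inner_zero_right)
    then show ?thesis by (simp only: inner_matrixD(4)[OF assms])
  qed
  then have "\<forall>x. A *v x = 0 \<longrightarrow> x = 0" by blast
  then have "\<exists>B. B ** A = mat 1" by (rule iffD2[OF matrix_left_invertible_ker])
  then show ?thesis using invertible_left_inverse[of A] by blast
qed

text \<open>The Christoffel symbols as a bilinear map: the covariant derivative in direction u of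
  the field with constant components w.\<close>

definition Gam :: "'d::finite metric_field \<Rightarrow> real^'d \<Rightarrow> real^'d \<Rightarrow> real^'d \<Rightarrow> real^'d" where
  "Gam G x u w = (\<chi> k. \<Sum>i\<in>UNIV. \<Sum>j\<in>UNIV. christoffel G x k i j * u $ i * w $ j)"

text \<open>Coordinate form of R(a,b)c for constant-component fields. Their bracket vanishes, so the
  sign convention leaves \<nabla>_b \<nabla>_a c - \<nabla>_a \<nabla>_b c.\<close>

definition Riem ::
  "'d::finite metric_field \<Rightarrow> real^'d \<Rightarrow> real^'d \<Rightarrow> real^'d \<Rightarrow> real^'d \<Rightarrow> real^'d" where
  "Riem G x a b c = dd (\<lambda>y. Gam G y a c) x b - dd (\<lambda>y. Gam G y b c) x a
     + Gam G x b (Gam G x a c) - Gam G x a (Gam G x b c)"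

lemma cov_Gam: "cov G X Y x = dd Y x (X x) + Gam G x (X x) (Y x)"
  by (simp add: cov_def Gam_def)

lemma linear_Gam: "linear (\<lambda>u. Gam G x u w)" "linear (Gam G x u)"
  by (rule linearI;
      simp add: Gam_def vec_eq_iff sum.distrib[symmetric] sum_distrib_left algebra_simps)+

lemmas Gam_simps =
  linear_add[OF linear_Gam(1)] linear_add[OF linear_Gam(2)]
  linear_diff[OF linear_Gam(1)] linear_diff[OF linear_Gam(2)]
  linear_neg[OF linear_Gam(1)] linear_neg[OF linear_Gam(2)]
  linear_scale[OF linear_Gam(1)] linear_scale[OF linear_Gam(2)]
  linear_0[OF linear_Gam(1)] linear_0[OF linear_Gam(2)]

locale chart_metric =
  fixes \<Omega> :: "(real^'d::finite) set" and G :: "'d metric_field"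
  assumes open_dom: "open \<Omega>"
    and smooth_metric: "smooth_on \<Omega> G"
    and inner_matrix: "x \<in> \<Omega> \<Longrightarrow> inner_matrix (G x)"
begin

lemma Ck_metric: "Ck_on k \<Omega> G"
  using smooth_metric by (simp add: smooth_on_def)

lemma metric_differentiable: "x \<in> \<Omega> \<Longrightarrow> G differentiable (at x)"
  by (rule Ck_on_differentiable[OF Ck_metric])

lemma Ck_christoffel: "Ck_on k \<Omega> (\<lambda>x. christoffel G x a b c)"
proof -
  have p: "Ck_on k \<Omega> (\<lambda>x. partial i (\<lambda>y. G y $ j $ l) x)" for i j l
    unfolding partial_def
    by (rule Ck_on_dd) (intro Ck_on_vec_nth open_dom Ck_metric)
  have inv: "Ck_on k \<Omega> (\<lambda>x. matrix_inv (G x))"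
    by (rule Ck_on_matrix_inv[OF open_dom inner_matrix_invertible Ck_metric]) (rule inner_matrix)
  show ?thesis
    unfolding christoffel_def
    by (intro Ck_on_mult Ck_on_const Ck_on_sum Ck_on_diff Ck_on_add open_dom p Ck_on_vec_nth inv)
qed

lemma Ck_Gam: "Ck_on k \<Omega> (\<lambda>x. Gam G x u w)"
  unfolding Gam_def
  by (intro Ck_on_vec_lambda Ck_on_sum Ck_on_mult Ck_on_const Ck_christoffel open_dom)

lemma Gam_differentiable: "x \<in> \<Omega> \<Longrightarrow> (\<lambda>x. Gam G x u w) differentiable (at x)"
  by (rule Ck_on_differentiable[OF Ck_Gam])

section \<open>The Levi-Civita connection: symmetry and metric compatibility\<close>

lemma partial_metric: "x \<in> \<Omega> \<Longrightarrow> partial i (\<lambda>y. G y $ j $ l) x = dd G x (axis i 1) $ j $ l"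
  unfolding partial_def
proof -
  assume x: "x \<in> \<Omega>"
  have "linear (\<lambda>A::real^'d^'d. A $ j $ l)" by (auto intro: linearI)
  from dd_linear[OF this metric_differentiable[OF x]]
  show "dd (\<lambda>y. G y $ j $ l) x (axis i 1) = dd G x (axis i 1) $ j $ l" .
qed

lemma dd_metric_sym:
  assumes x: "x \<in> \<Omega>"
  shows "dd G x u $ i $ j = dd G x u $ j $ i"
proof -
  have l: "linear (\<lambda>A::real^'d^'d. A $ i $ j)" for i j by (auto intro: linearI)
  have d: "(\<lambda>y. G y $ i $ j) differentiable (at x)"
    by (rule Ck_on_differentiable[OF Ck_on_linear[OF open_dom l Ck_metric] x])
  have "dd (\<lambda>y. G y $ i $ j) x u = dd (\<lambda>y. G y $ j $ i) x u"
    by (rule dd_cong[OF d open_dom x]) (rule inner_matrix_nth_sym[OF inner_matrix])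
  then show ?thesis by (simp add: dd_linear[OF l metric_differentiable[OF x]])
qed

lemma form_dd_metric_sym: "x \<in> \<Omega> \<Longrightarrow> form (dd G x u) v w = form (dd G x u) w v"
  unfolding form_sum by (subst sum.swap) (simp add: dd_metric_sym[of x u] mult_ac)

lemma Gam_sym:
  assumes "x \<in> \<Omega>" shows "Gam G x u w = Gam G x w u"
proof -
  have c: "christoffel G x k i j = christoffel G x k j i" for k i j
    unfolding christoffel_def partial_metric[OF assms]
    by (simp add: dd_metric_sym[OF assms, of _ i j] add.commute)
  show ?thesis
    unfolding Gam_def
    by (subst sum.swap) (simp add: c[of _ _ _] mult_ac)
qed

text \<open>Lowering the index: the metric cancels its inverse in the Christoffel symbols and only
  first derivatives of the metric remain.\<close>

lemma metric_Gam_nth: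
  assumes x: "x \<in> \<Omega>"
  shows "(G x *v Gam G x u w) $ m = (1/2) * (\<Sum>i\<in>UNIV. \<Sum>j\<in>UNIV.
    (dd G x (axis i 1) $ j $ m + dd G x (axis j 1) $ i $ m - dd G x (axis m 1) $ i $ j) * u $ i * w $ j)"
proof -
  define t where "t i j l =
    dd G x (axis i 1) $ j $ l + dd G x (axis j 1) $ i $ l - dd G x (axis l 1) $ i $ j" for i j l
  have ch: "christoffel G x k i j = (1/2) * (matrix_inv (G x) *v (\<chi> l. t i j l)) $ k" for k i j
    by (simp add: christoffel_def partial_metric[OF x] t_def matrix_vector_mult_def)
  have "Gam G x u w = matrix_inv (G x) *v (\<Sum>i\<in>UNIV. \<Sum>j\<in>UNIV. (u $ i * w $ j / 2) *\<^sub>R (\<chi> l. t i j l))"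
    unfolding Gam_def ch
    by (simp add: vec_eq_iff linear_sum[OF matrix_vector_mul_linear] matrix_vector_mult_scaleR mult_ac)
  then have "G x *v Gam G x u w = (\<Sum>i\<in>UNIV. \<Sum>j\<in>UNIV. (u $ i * w $ j / 2) *\<^sub>R (\<chi> l. t i j l))"
    using matrix_inv_both(1)[OF inner_matrix_invertible[OF inner_matrix[OF x]]]
    by (simp add: matrix_vector_mul_assoc)
  then show ?thesis
    by (simp add: t_def[symmetric] sum_distrib_left mult_ac)
qed

lemma dd_metric_expand:
  assumes x: "x \<in> \<Omega>"
  shows "dd G x u $ j $ m = (\<Sum>i\<in>UNIV. u $ i * dd G x (axis i 1) $ j $ m)"
proof -
  have l: "linear (dd G x)" by (rule linear_dd[OF metric_differentiable[OF x]])
  have "u = (\<Sum>i\<in>UNIV. u $ i *\<^sub>R axis i 1)"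
    by (simp add: vec_eq_iff axis_def if_distrib sum.delta cong: if_cong)
  then have "dd G x u = dd G x (\<Sum>i\<in>UNIV. u $ i *\<^sub>R axis i 1)" by simp
  also have "\<dots> = (\<Sum>i\<in>UNIV. u $ i *\<^sub>R dd G x (axis i 1))"
    by (simp add: linear_sum[OF l] linear_scale[OF l])
  finally show ?thesis by simp
qed

text \<open>Koszul's formula for constant-component fields, whose brackets vanish. Each of the three
  terms in the lowered Christoffel symbol becomes a derivative of the metric after its triple sum is
  reordered.\<close>

lemma Koszul:
  assumes x: "x \<in> \<Omega>"
  shows "2 * form (G x) (Gam G x u w) z =
    form (dd G x u) w z + form (dd G x w) u z - form (dd G x z) u w"
proof -
  define c where "c i j m = dd G x (axis i 1) $ j $ m" for i j m
  have "2 * form (G x) (Gam G x u w) z = 2 * (z \<bullet> (G x *v Gam G x u w))"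
    using inner_matrixD(1)[OF inner_matrix[OF x]] by (simp add: form_def)
  also have "\<dots> = (\<Sum>m\<in>UNIV. \<Sum>i\<in>UNIV. \<Sum>j\<in>UNIV. (c i j m + c j i m - c m i j) * u $ i * w $ j * z $ m)"
  proof -
    have "2 * (z \<bullet> (G x *v Gam G x u w)) = (\<Sum>m\<in>UNIV. 2 * (G x *v Gam G x u w) $ m * z $ m)"
      by (simp add: inner_vec_def sum_distrib_left mult_ac)
    then show ?thesis
      by (simp add: metric_Gam_nth[OF x] c_def sum_distrib_right)
  qed
  also have "\<dots> = (\<Sum>m\<in>UNIV. \<Sum>i\<in>UNIV. \<Sum>j\<in>UNIV. c i j m * u $ i * w $ j * z $ m)
     + (\<Sum>m\<in>UNIV. \<Sum>i\<in>UNIV. \<Sum>j\<in>UNIV. c j i m * u $ i * w $ j * z $ m)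
     - (\<Sum>m\<in>UNIV. \<Sum>i\<in>UNIV. \<Sum>j\<in>UNIV. c m i j * u $ i * w $ j * z $ m)"
    by (simp add: sum.distrib[symmetric] sum_subtractf[symmetric] algebra_simps)
  also have "(\<Sum>m\<in>UNIV. \<Sum>i\<in>UNIV. \<Sum>j\<in>UNIV. c i j m * u $ i * w $ j * z $ m) = form (dd G x u) w z"
  proof -
    have "form (dd G x u) w z = (\<Sum>j\<in>UNIV. \<Sum>m\<in>UNIV. \<Sum>i\<in>UNIV. c i j m * u $ i * w $ j * z $ m)"
      by (simp add: form_sum dd_metric_expand[OF x, of u] c_def sum_distrib_left sum_distrib_right mult_ac)
    also have "\<dots> = (\<Sum>m\<in>UNIV. \<Sum>j\<in>UNIV. \<Sum>i\<in>UNIV. c i j m * u $ i * w $ j * z $ m)" by (rule sum.swap)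
    also have "\<dots> = (\<Sum>m\<in>UNIV. \<Sum>i\<in>UNIV. \<Sum>j\<in>UNIV. c i j m * u $ i * w $ j * z $ m)"
      by (rule sum.cong[OF refl]) (rule sum.swap)
    finally show ?thesis by simp
  qed
  also have "(\<Sum>m\<in>UNIV. \<Sum>i\<in>UNIV. \<Sum>j\<in>UNIV. c j i m * u $ i * w $ j * z $ m) = form (dd G x w) u z"
  proof -
    have "form (dd G x w) u z = (\<Sum>i\<in>UNIV. \<Sum>m\<in>UNIV. \<Sum>j\<in>UNIV. c j i m * u $ i * w $ j * z $ m)"
      by (simp add: form_sum dd_metric_expand[OF x, of w] c_def sum_distrib_left sum_distrib_right mult_ac)
    also have "\<dots> = (\<Sum>m\<in>UNIV. \<Sum>i\<in>UNIV. \<Sum>j\<in>UNIV. c j i m * u $ i * w $ j * z $ m)" by (rule sum.swap)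
    finally show ?thesis by simp
  qed
  also have "(\<Sum>m\<in>UNIV. \<Sum>i\<in>UNIV. \<Sum>j\<in>UNIV. c m i j * u $ i * w $ j * z $ m) = form (dd G x z) u w"
  proof -
    have "form (dd G x z) u w = (\<Sum>i\<in>UNIV. \<Sum>j\<in>UNIV. \<Sum>m\<in>UNIV. c m i j * u $ i * w $ j * z $ m)"
      by (simp add: form_sum dd_metric_expand[OF x, of z] c_def sum_distrib_left sum_distrib_right mult_ac)
    also have "\<dots> = (\<Sum>i\<in>UNIV. \<Sum>m\<in>UNIV. \<Sum>j\<in>UNIV. c m i j * u $ i * w $ j * z $ m)"
      by (rule sum.cong[OF refl]) (rule sum.swap)
    also have "\<dots> = (\<Sum>m\<in>UNIV. \<Sum>i\<in>UNIV. \<Sum>j\<in>UNIV. c m i j * u $ i * w $ j * z $ m)" by (rule sum.swap)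
    finally show ?thesis by simp
  qed
  finally show ?thesis .
qed

text \<open>In the sum of Koszul's formula for (v, a, b) and for (v, b, a) the derivatives in the
  directions a and b cancel, and twice the derivative in direction v remains.\<close>

lemma metric_compatible:
  assumes x: "x \<in> \<Omega>"
  shows "form (dd G x v) a b = form (G x) (Gam G x v a) b + form (G x) a (Gam G x v b)"
proof -
  have s: "form (G x) a (Gam G x v b) = form (G x) (Gam G x v b) a"
    by (rule inner_matrixD(1)[OF inner_matrix[OF x]])
  show ?thesis
    using Koszul[OF x, of v a b] Koszul[OF x, of v b a]
      form_dd_metric_sym[OF x, of v a b] unfolding s by linarith
qed

section \<open>The curvature tensor and its covariant derivative\<close>

lemma Ck_Riem: "Ck_on k \<Omega> (\<lambda>x. Riem G x a b c)"
  unfolding Riem_def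
  by (intro Ck_on_add Ck_on_diff open_dom Ck_on_dd Ck_Gam
      Ck_on_linear_family[OF open_dom linear_Gam(2)])

lemma linear_Riem:
  assumes x: "x \<in> \<Omega>"
  shows "linear (\<lambda>a. Riem G x a b c)" "linear (\<lambda>b. Riem G x a b c)" "linear (\<lambda>c. Riem G x a b c)"
proof -
  note d = Gam_differentiable[OF x]
  have lin: "linear (\<lambda>z. r *\<^sub>R z :: real^'d)" for r
    by (simp add: linear_iff scaleR_add_right)
  have sc: "dd (\<lambda>y. r *\<^sub>R Gam G y u w) x v = r *\<^sub>R dd (\<lambda>y. Gam G y u w) x v" for r u v w
    by (rule dd_linear[OF lin d])
  have l: "linear (dd (\<lambda>y. Gam G y u w) x)" for u w by (rule linear_dd[OF d])
  show "linear (\<lambda>a. Riem G x a b c)" "linear (\<lambda>b. Riem G x a b c)" "linear (\<lambda>c. Riem G x a b c)"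
    by (rule linearI;
        simp add: Riem_def dd_add[OF d d] sc Gam_simps linear_add[OF l] linear_scale[OF l] algebra_simps)+
qed

lemma dd_Gam_fields:
  assumes x: "x \<in> \<Omega>" and X: "X differentiable (at x)" and Y: "Y differentiable (at x)"
  shows "(\<lambda>y. Gam G y (X y) (Y y)) differentiable (at x)"
    and "dd (\<lambda>y. Gam G y (X y) (Y y)) x v =
      dd (\<lambda>y. Gam G y (X x) (Y x)) x v + Gam G x (dd X x v) (Y x) + Gam G x (X x) (dd Y x v)"
proof -
  have i: "(\<lambda>y. Gam G y a (Y y)) differentiable (at x)"
    "dd (\<lambda>y. Gam G y a (Y y)) x v = dd (\<lambda>y. Gam G y a (Y x)) x v + Gam G x a (dd Y x v)" for a
    by (rule differentiable_linear_family[where L="\<lambda>y. Gam G y a", OF open_dom x linear_Gam(2) Gam_differentiable[OF x] Y]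
        dd_linear_family[where L="\<lambda>y. Gam G y a", OF open_dom x linear_Gam(2) Gam_differentiable[OF x] Y])+
  show "(\<lambda>y. Gam G y (X y) (Y y)) differentiable (at x)"
    by (rule differentiable_linear_family[where L="\<lambda>y a. Gam G y a (Y y)", OF open_dom x linear_Gam(1) i(1) X])
  have "dd (\<lambda>y. Gam G y (X y) (Y y)) x v = dd (\<lambda>y. Gam G y (X x) (Y y)) x v + Gam G x (dd X x v) (Y x)"
    by (rule dd_linear_family[where L="\<lambda>y a. Gam G y a (Y y)", OF open_dom x linear_Gam(1) i(1) X])
  then show "dd (\<lambda>y. Gam G y (X y) (Y y)) x v =
      dd (\<lambda>y. Gam G y (X x) (Y x)) x v + Gam G x (dd X x v) (Y x) + Gam G x (X x) (dd Y x v)"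
    by (simp add: i(2))
qed

lemma dd_cov:
  assumes x: "x \<in> \<Omega>" and Y: "Y differentiable (at x)" and Z: "Ck_on 2 \<Omega> Z"
  shows "cov G Y Z differentiable (at x)"
    and "dd (cov G Y Z) x v = dd (\<lambda>y. dd Z y (Y x)) x v + dd Z x (dd Y x v)
      + (dd (\<lambda>y. Gam G y (Y x) (Z x)) x v + Gam G x (dd Y x v) (Z x) + Gam G x (Y x) (dd Z x v))"
proof -
  have dZ: "Z differentiable (at y)" "(\<lambda>y. dd Z y a) differentiable (at y)" if "y \<in> \<Omega>" for y a
    using Z that by (simp_all add: numeral_2_eq_2)
  have lZ: "linear (dd Z y)" if "y \<in> \<Omega>" for y using linear_dd[OF dZ(1)[OF that]] .
  note Zf = differentiable_linear_family[where L="\<lambda>y. dd Z y", OF open_dom x lZ dZ(2)[OF x] Y]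
    dd_linear_family[where L="\<lambda>y. dd Z y", OF open_dom x lZ dZ(2)[OF x] Y]
  note Gf = dd_Gam_fields[OF x Y dZ(1)[OF x]]
  have e: "cov G Y Z = (\<lambda>y. dd Z y (Y y) + Gam G y (Y y) (Z y))"
    by (simp add: fun_eq_iff cov_Gam)
  show "cov G Y Z differentiable (at x)"
    unfolding e by (intro differentiable_add Zf(1) Gf(1))
  show "dd (cov G Y Z) x v = dd (\<lambda>y. dd Z y (Y x)) x v + dd Z x (dd Y x v)
      + (dd (\<lambda>y. Gam G y (Y x) (Z x)) x v + Gam G x (dd Y x v) (Z x) + Gam G x (Y x) (dd Z x v))"
    unfolding e by (simp only: dd_add[OF Zf(1) Gf(1)] Zf(2) Gf(2))
qed

text \<open>The second derivatives of Z cancel by symmetry, and the derivatives of X and Y are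
  absorbed by the bracket term. This matters because covariant derivatives of constant-component
  fields no longer have constant components.\<close>

lemma curv_tensorial:
  assumes x: "x \<in> \<Omega>" and X: "X differentiable (at x)" and Y: "Y differentiable (at x)"
    and Z: "Ck_on 2 \<Omega> Z"
  shows "curv G X Y Z x = Riem G x (X x) (Y x) (Z x)"
proof -
  have dZ: "Z differentiable (at x)" using Z x by (simp add: numeral_2_eq_2)
  note lZ = linear_diff[OF linear_dd[OF dZ]]
  have c1: "cov G X (cov G Y Z) x = dd (cov G Y Z) x (X x) + Gam G x (X x) (cov G Y Z x)" for X Y
    by (rule cov_Gam)
  have comm: "dd (\<lambda>y. dd Z y (Y x)) x (X x) = dd (\<lambda>y. dd Z y (X x)) x (Y x)"
    by (rule dd_dd_commute[OF open_dom x Z])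
  show ?thesis
    unfolding curv_def c1 cov_Gam[of G "lie_bracket X Y"] lie_bracket_def dd_cov(2)[OF x X Z] dd_cov(2)[OF x Y Z]
      cov_Gam[of G Y Z] cov_Gam[of G X Z] comm lZ Gam_simps Riem_def
    by (simp add: algebra_simps)
qed

lemma jacobi_op_mult:
  assumes x: "x \<in> \<Omega>"
  shows "jacobi_op G x a *v v = Riem G x a v a"
proof -
  have "(\<lambda>v. curv G (\<lambda>_. a) (\<lambda>_. v) (\<lambda>_. a) x) = (\<lambda>v. Riem G x a v a)"
    by (rule ext) (rule curv_tensorial[OF x], simp_all add: Ck_on_const)
  then show ?thesis
    using linear_Riem(2)[OF x] by (simp add: jacobi_op_def matrix_works)
qed

definition parallel_curv :: bool where
  "parallel_curv \<longleftrightarrow> (\<forall>W X Y Z. \<forall>x\<in>\<Omega>. smooth_on \<Omega> W \<longrightarrow> smooth_on \<Omega> X \<longrightarrow>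
     smooth_on \<Omega> Y \<longrightarrow> smooth_on \<Omega> Z \<longrightarrow> nabla_curv G W X Y Z x = 0)"

text \<open>The condition \<nabla>R = 0 is tested on constant-component fields. Their covariant
  derivatives are values of \<open>Gam\<close>, and tensoriality lets these be inserted into
  \<open>Riem\<close> at the point.\<close>

lemma parallel_Riem:
  assumes par: parallel_curv and x: "x \<in> \<Omega>"
  shows "dd (\<lambda>y. Riem G y a b c) x w = Riem G x (Gam G x w a) b c + Riem G x a (Gam G x w b) c
      + Riem G x a b (Gam G x w c) - Gam G x w (Riem G x a b c)"
proof -
  have sm: "smooth_on \<Omega> (\<lambda>_. u)" for u :: "real^'d" by (simp add: smooth_on_def Ck_on_const)
  have cc: "cov G (\<lambda>_. w) (\<lambda>_. u) = (\<lambda>y. Gam G y w u)" for w u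
    by (simp add: fun_eq_iff cov_Gam)
  have R: "curv G (\<lambda>_. a) (\<lambda>_. b) (\<lambda>_. c) y = Riem G y a b c" if "y \<in> \<Omega>" for y
    by (rule curv_tensorial[OF that]) (simp_all add: Ck_on_const)
  have dR: "(\<lambda>y. Riem G y a b c) differentiable (at x)"
    by (rule Ck_on_differentiable[OF Ck_Riem x])
  have "dd (curv G (\<lambda>_. a) (\<lambda>_. b) (\<lambda>_. c)) x w = dd (\<lambda>y. Riem G y a b c) x w"
    by (rule dd_cong[symmetric, OF dR open_dom x]) (simp add: R)
  moreover have "curv G (\<lambda>y. Gam G y w a) (\<lambda>_. b) (\<lambda>_. c) x = Riem G x (Gam G x w a) b c"
    by (rule curv_tensorial[OF x Gam_differentiable[OF x]]) (simp_all add: Ck_on_const)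
  moreover have "curv G (\<lambda>_. a) (\<lambda>y. Gam G y w b) (\<lambda>_. c) x = Riem G x a (Gam G x w b) c"
    by (rule curv_tensorial[OF x _ Gam_differentiable[OF x]]) (simp_all add: Ck_on_const)
  moreover have "curv G (\<lambda>_. a) (\<lambda>_. b) (\<lambda>y. Gam G y w c) x = Riem G x a b (Gam G x w c)"
    by (rule curv_tensorial[OF x _ _ Ck_Gam]) simp_all
  moreover have "nabla_curv G (\<lambda>_. w) (\<lambda>_. a) (\<lambda>_. b) (\<lambda>_. c) x = 0"
    using par x sm unfolding parallel_curv_def by blast
  ultimately show ?thesis
    unfolding nabla_curv_def cov_Gam[of G "\<lambda>_. w" "curv _ _ _ _"] cc R[OF x] by (simp add: algebra_simps)
qed

end

section \<open>The Riccati equation along the gradient\<close>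

lemma linear_trace: "linear (trace :: real^'n^'n \<Rightarrow> real)"
  by (rule linearI) (simp_all add: trace_def sum.distrib sum_distrib_left)

lemma bounded_bilinear_matrix_mult:
  "bounded_bilinear ((**) :: real^'n^'n \<Rightarrow> real^'n^'n \<Rightarrow> real^'n^'n)"
  unfolding bilinear_conv_bounded_bilinear[symmetric] bilinear_def
  by (auto intro!: linearI simp: matrix_matrix_mult_def vec_eq_iff sum.distrib[symmetric]
      sum_distrib_left algebra_simps)

lemma matrix_mult_simps:
  fixes A B C :: "real^'n^'n"
  shows "(A + B) ** C = A ** C + B ** C" "C ** (A + B) = C ** A + C ** B"
    "(A - B) ** C = A ** C - B ** C" "C ** (A - B) = C ** A - C ** B"
    "(r *\<^sub>R A) ** C = r *\<^sub>R (A ** C)" "C ** (r *\<^sub>R A) = r *\<^sub>R (C ** A)"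
    "(- A) ** C = - (A ** C)" "C ** (- A) = - (C ** A)"
  by (simp_all add: bounded_bilinear.add_left[OF bounded_bilinear_matrix_mult]
      bounded_bilinear.add_right[OF bounded_bilinear_matrix_mult]
      bounded_bilinear.diff_left[OF bounded_bilinear_matrix_mult]
      bounded_bilinear.diff_right[OF bounded_bilinear_matrix_mult]
      bounded_bilinear.scaleR_left[OF bounded_bilinear_matrix_mult]
      bounded_bilinear.scaleR_right[OF bounded_bilinear_matrix_mult]
      bounded_bilinear.minus_left[OF bounded_bilinear_matrix_mult]
      bounded_bilinear.minus_right[OF bounded_bilinear_matrix_mult])

lemmas trace_simps =
  linear_add[OF linear_trace] linear_diff[OF linear_trace] linear_scale[OF linear_trace]
  linear_neg[OF linear_trace]

text \<open>Meant for the rank-one term V df of the Riccati equation: its trace against M only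
  requires M applied to V.\<close>

lemma trace_rank_one_mult:
  fixes u :: "real^'n" and M :: "real^'n^'n"
  assumes "linear f"
  shows "trace (matrix (\<lambda>v. f v *\<^sub>R u) ** M) = f (M *v u)"
proof -
  have "M *v u = (\<Sum>k\<in>UNIV. (\<Sum>i\<in>UNIV. M $ k $ i * u $ i) *\<^sub>R axis k 1)"
    by (simp add: vec_eq_iff matrix_vector_mult_def axis_def if_distrib sum.delta cong: if_cong)
  then have "f (M *v u) = (\<Sum>k\<in>UNIV. (\<Sum>i\<in>UNIV. M $ k $ i * u $ i) * f (axis k 1))"
    by (simp add: linear_sum[OF assms] linear_scale[OF assms])
  also have "\<dots> = (\<Sum>k\<in>UNIV. \<Sum>i\<in>UNIV. f (axis k 1) * u $ i * M $ k $ i)"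
    by (simp add: sum_distrib_right sum_distrib_left mult_ac)
  also have "\<dots> = (\<Sum>i\<in>UNIV. \<Sum>k\<in>UNIV. f (axis k 1) * u $ i * M $ k $ i)" by (rule sum.swap)
  also have "\<dots> = trace (matrix (\<lambda>v. f v *\<^sub>R u) ** M)"
    by (simp add: trace_def matrix_matrix_mult_def matrix_def)
  finally show ?thesis by simp
qed

text \<open>The mechanism that removes the connection matrix from the traces: P will be the
  identity, H or its square.\<close>

lemma trace_commutator:
  fixes H A P :: "real^'n^'n"
  assumes "H ** P = P ** H"
  shows "trace ((H ** A - A ** H) ** P) = 0"
proof -
  have "trace (H ** A ** P) = trace (H ** (A ** P))" by (simp only: matrix_mul_assoc)
  also have "\<dots> = trace (A ** P ** H)" by (rule trace_mul_sym)
  also have "\<dots> = trace (A ** H ** P)" by (simp only: matrix_mul_assoc[symmetric] assms)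
  finally show ?thesis by (simp add: matrix_mult_simps trace_simps)
qed

lemma Ck_on_matrix:
  fixes L :: "'a::euclidean_space \<Rightarrow> real^'n \<Rightarrow> real^'m"
  assumes "open S" "\<And>v. Ck_on k S (\<lambda>x. L x v)"
  shows "Ck_on k S (\<lambda>x. matrix (L x))"
  unfolding matrix_def by (intro Ck_on_vec_lambda Ck_on_vec_nth assms)

lemma Ck_on_trace: "open S \<Longrightarrow> Ck_on k S M \<Longrightarrow> Ck_on k S (\<lambda>x. trace (M x))"
  for M :: "'a::euclidean_space \<Rightarrow> real^'n^'n"
  by (rule Ck_on_linear[OF _ linear_trace])

lemmas Ck_on_matrix_mult = Ck_on_bilinear[OF _ bounded_bilinear_matrix_mult]

lemma dd_chain_real:
  fixes F :: "'a::euclidean_space \<Rightarrow> real" and c :: "real \<Rightarrow> real"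
  assumes "F differentiable (at x)" "c differentiable (at (F x))"
  shows "(\<lambda>y. c (F y)) differentiable (at x)" "dd (\<lambda>y. c (F y)) x v = dd c (F x) 1 * dd F x v"
proof -
  have d: "((\<lambda>y. c (F y)) has_derivative (\<lambda>v. dd c (F x) (dd F x v))) (at x)"
    by (rule has_derivative_compose[where g=c, OF has_derivative_dd[OF assms(1)]])
       (rule has_derivative_dd[OF assms(2)])
  then show "(\<lambda>y. c (F y)) differentiable (at x)" by (auto simp: differentiable_def)
  have "dd c (F x) (dd F x v *\<^sub>R 1) = dd F x v *\<^sub>R dd c (F x) 1"
    by (rule linear_scale[OF linear_dd[OF assms(2)]])
  then show "dd (\<lambda>y. c (F y)) x v = dd c (F x) 1 * dd F x v"
    using dd_eq[OF d] by simp
qed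

lemma matrix_vector_mult_minus: "(- M) *v v = - (M *v v)" for M :: "real^'n^'m"
  by (simp add: matrix_vector_mult_def vec_eq_iff sum_negf)

lemma form_minus: "form B (- u) v = - form B u v"
  by (simp add: form_def)

locale chart_function = chart_metric \<Omega> G for \<Omega> :: "(real^'d::finite) set" and G +
  fixes S :: "(real^'d) set" and F :: "real^'d \<Rightarrow> real" and b :: "real \<Rightarrow> real"
  assumes open_S: "open S" and S_subset: "S \<subseteq> \<Omega>"
    and smooth_F: "smooth_on S F" and smooth_b: "smooth_on UNIV b"
    and norm_gradient: "x \<in> S \<Longrightarrow> form (G x) (gradient G F x) (gradient G F x) = b (F x)"
begin

abbreviation "V \<equiv> gradient G F"
abbreviation "H \<equiv> hessian_op G F"
abbreviation "K x \<equiv> jacobi_op G x (V x)"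

definition b1 :: "real \<Rightarrow> real" where "b1 t = dd b t 1"
definition b2 :: "real \<Rightarrow> real" where "b2 t = dd b1 t 1"

lemma b_differentiable: "b differentiable (at t)" "b1 differentiable (at t)"
  using smooth_b unfolding smooth_on_def b1_def[abs_def]
  by (auto dest: spec[of _ 2] simp: numeral_2_eq_2)

lemma Ck_F: "Ck_on k S F"
  using smooth_F by (simp add: smooth_on_def)

lemma F_differentiable: "x \<in> S \<Longrightarrow> F differentiable (at x)"
  by (rule Ck_on_differentiable[OF Ck_F])

lemma Ck_S: "Ck_on k \<Omega> f \<Longrightarrow> Ck_on k S f"
  using Ck_on_subset S_subset by blast

lemma Ck_gradient: "Ck_on k S V"
proof -
  have "Ck_on k S (\<lambda>x. matrix_inv (G x) *v (\<chi> i. dd F x (axis i 1)))"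
  proof (rule Ck_on_linear_family[where L="\<lambda>x a. matrix_inv (G x) *v a" and X="\<lambda>x. \<chi> i. dd F x (axis i 1)", OF open_S])
    show "Ck_on k S (\<lambda>x. matrix_inv (G x) *v u)" for u
    proof (rule Ck_on_linear[where h="\<lambda>A. A *v u", OF open_S])
      show "linear (\<lambda>A::real^'d^'d. A *v u)"
        by (rule linearI) (simp_all add: matrix_vector_mult_add_rdistrib scaleR_matrix_vector_assoc)
      show "Ck_on k S (\<lambda>x. matrix_inv (G x))"
        by (rule Ck_S[OF Ck_on_matrix_inv[OF open_dom inner_matrix_invertible Ck_metric]]) (rule inner_matrix)
    qed
    show "Ck_on k S (\<lambda>x. \<chi> i. dd F x (axis i 1))"
      by (intro Ck_on_vec_lambda open_S Ck_on_dd Ck_F)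
  qed simp
  then show ?thesis by (simp add: gradient_def[abs_def] partial_def)
qed

lemma V_differentiable: "x \<in> S \<Longrightarrow> V differentiable (at x)"
  by (rule Ck_on_differentiable[OF Ck_gradient])

lemma form_gradient:
  assumes x: "x \<in> S"
  shows "form (G x) (V x) v = dd F x v"
proof -
  have inv: "invertible (G x)" using x S_subset by (intro inner_matrix_invertible inner_matrix) auto
  have l: "linear (dd F x)" by (rule linear_dd[OF F_differentiable[OF x]])
  have v: "v = (\<Sum>i\<in>UNIV. v $ i *\<^sub>R axis i 1)"
    by (simp add: vec_eq_iff axis_def if_distrib sum.delta cong: if_cong)
  have "form (G x) (V x) v = v \<bullet> (G x *v V x)"
    using x S_subset inner_matrixD(1)[OF inner_matrix, of x "V x" v] by (auto simp: form_def)
  also have "G x *v V x = (\<chi> i. dd F x (axis i 1))"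
    using matrix_inv_both(1)[OF inv]
    by (simp add: gradient_def partial_def matrix_vector_mul_assoc)
  also have "v \<bullet> (\<chi> i. dd F x (axis i 1)) = (\<Sum>i\<in>UNIV. v $ i * dd F x (axis i 1))"
    by (simp add: inner_vec_def)
  also have "\<dots> = dd F x v"
    by (subst (2) v) (simp add: linear_sum[OF l] linear_scale[OF l])
  finally show ?thesis .
qed

lemma dd_F_gradient: "x \<in> S \<Longrightarrow> dd F x (V x) = b (F x)"
  using form_gradient norm_gradient by metis

section \<open>The Hessian of a function whose gradient length depends on its value only\<close>

lemma hessian_mult:
  assumes x: "x \<in> S"
  shows "H x *v v = dd V x v + Gam G x v (V x)"
proof -
  have "linear (\<lambda>v. dd V x v + Gam G x v (V x))"
    by (intro linear_compose_add linear_dd V_differentiable x linear_Gam)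
  then show ?thesis
    by (simp add: hessian_op_def cov_Gam matrix_works)
qed

lemma dd_gradient: "x \<in> S \<Longrightarrow> dd V x v = H x *v v - Gam G x v (V x)"
  by (simp add: hessian_mult)

text \<open>Differentiating g(V, w) = dF(w) for constant w, with metric compatibility for the
  derivative of g. As g(V, .) = dF, this is the classical second derivative of F minus dF of the
  Christoffel term.\<close>

lemma form_hessian:
  assumes x: "x \<in> S"
  shows "form (G x) (H x *v u) w = dd (\<lambda>y. dd F y w) x u - form (G x) (V x) (Gam G x u w)"
proof -
  have x': "x \<in> \<Omega>" using x S_subset by blast
  have "linear (\<lambda>A. form A a w)" for a :: "real^'d"
    by (rule linearI) (simp_all add: form_matrix_simps)
  note l1 = dd_linear[OF this metric_differentiable[OF x']]
  have dl: "(\<lambda>y. form (G y) a w) differentiable (at x)" for a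
    by (rule Ck_on_differentiable[OF Ck_on_linear[OF open_dom _ Ck_metric] x'])
       (rule linearI, simp_all add: form_matrix_simps)
  have "dd (\<lambda>y. form (G y) (V y) w) x u = dd (\<lambda>y. form (G y) (V x) w) x u + form (G x) (dd V x u) w"
    by (rule dd_linear_family[where L="\<lambda>y a. form (G y) a w", OF open_dom x' _ dl V_differentiable[OF x]])
       (rule linearI, simp_all add: form_simps)
  moreover have "dd (\<lambda>y. dd F y w) x u = dd (\<lambda>y. form (G y) (V y) w) x u"
    by (rule dd_cong[OF _ open_S x])
       (use Ck_F[of 2] x in \<open>simp_all add: form_gradient numeral_2_eq_2\<close>)
  ultimately show ?thesis
    by (simp add: l1 metric_compatible[OF x'] hessian_mult[OF x] form_simps)
qed

text \<open>Both parts of \<open>form_hessian\<close> are symmetric: the second derivative by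
  equality of mixed derivatives, the Christoffel term because the connection is
  torsion-free.\<close>

lemma hessian_self_adjoint:
  assumes x: "x \<in> S"
  shows "self_adjoint (G x) (H x)"
proof -
  have x': "x \<in> \<Omega>" using x S_subset by blast
  have "form (G x) (H x *v u) w = form (G x) (H x *v w) u" for u w
    unfolding form_hessian[OF x]
    using dd_dd_commute[OF open_S x Ck_F, of w u] Gam_sym[OF x', of u w] by simp
  then show ?thesis
    unfolding self_adjoint_def using inner_matrixD(1)[OF inner_matrix[OF x']] by metis
qed

text \<open>The derivative of g(V, V) = b(F) in direction u is 2 g(H u, V) = b' dF(u), and H moves
  to the other side by self-adjointness.\<close>

lemma hessian_gradient:
  assumes x: "x \<in> S"
  shows "H x *v V x = (b1 (F x) / 2) *\<^sub>R V x"
proof (rule form_nondegenerate)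
  have x': "x \<in> \<Omega>" using x S_subset by blast
  show G: "inner_matrix (G x)" by (rule inner_matrix[OF x'])
  fix u
  have e: "dd F y (V y) = b (F y)" if "y \<in> S" for y by (rule dd_F_gradient[OF that])
  have dF: "(\<lambda>y. dd F y a) differentiable (at x)" for a
    using Ck_F[of 2] x by (simp add: numeral_2_eq_2)
  note fam = dd_linear_family[where L="\<lambda>y. dd F y", OF open_S x linear_dd[OF F_differentiable] dF V_differentiable[OF x]]
  have "b1 (F x) * dd F x u = dd (\<lambda>y. b (F y)) x u"
    using dd_chain_real(2)[OF F_differentiable[OF x] b_differentiable(1)] by (simp add: b1_def)
  also have "\<dots> = dd (\<lambda>y. dd F y (V y)) x u"
    by (rule dd_cong[OF dd_chain_real(1)[OF F_differentiable[OF x] b_differentiable(1)] open_S x]) (simp add: e)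
  also have "\<dots> = dd (\<lambda>y. dd F y (V x)) x u + dd F x (dd V x u)" by (rule fam)
  \<comment> \<open>The Christoffel term subtracted in \<open>form_hessian\<close> is restored here,
    and joins the derivative of V to form \<open>H x *v u\<close>.\<close>
  also have "\<dots> = form (G x) (H x *v u) (V x) + form (G x) (V x) (Gam G x u (V x) + dd V x u)"
    by (simp add: form_hessian[OF x] form_gradient[OF x, symmetric] form_simps)
  also have "\<dots> = 2 * form (G x) (H x *v V x) u"
    using hessian_self_adjoint[OF x] inner_matrixD(1)[OF G]
    by (simp add: hessian_mult[OF x, symmetric] add.commute self_adjoint_def)
  finally show "form (G x) (H x *v V x) u = form (G x) ((b1 (F x) / 2) *\<^sub>R V x) u"
    by (simp add: form_simps form_gradient[OF x])
qed

lemma Ck_hessian: "Ck_on k S H"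
proof -
  have "Ck_on k S (\<lambda>x. dd V x v + Gam G x v (V x))" for v
    by (intro Ck_on_add open_S Ck_on_dd Ck_gradient
        Ck_on_linear_family[where L="\<lambda>x. Gam G x v", OF open_S linear_Gam(2) Ck_S[OF Ck_Gam] Ck_gradient])
  from Ck_on_matrix[OF open_S this] show ?thesis
    by (simp add: hessian_op_def[abs_def] cov_Gam)
qed

lemma Ck_Riem_gradient: "Ck_on k S (\<lambda>x. Riem G x (V x) v (V x))"
proof -
  have i: "Ck_on k S (\<lambda>x. Riem G x a v (V x))" for a
    by (rule Ck_on_linear_family[where L="\<lambda>x. Riem G x a v", OF open_S linear_Riem(3) Ck_S[OF Ck_Riem] Ck_gradient])
       (use S_subset in auto)
  show ?thesis
    by (rule Ck_on_linear_family[where L="\<lambda>x a. Riem G x a v (V x)", OF open_S linear_Riem(1) i Ck_gradient])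
       (use S_subset in auto)
qed

lemma jacobi_mult: "x \<in> S \<Longrightarrow> K x *v v = Riem G x (V x) v (V x)"
  using jacobi_op_mult S_subset by blast

lemma Ck_jacobi: "Ck_on k S K"
proof (rule Ck_on_cong_imp[OF open_S _ Ck_on_matrix[OF open_S Ck_Riem_gradient]])
  fix x assume "x \<in> S"
  then show "matrix (\<lambda>v. Riem G x (V x) v (V x)) = K x"
    by (simp add: jacobi_mult[symmetric])
qed

section \<open>The Riccati equation and the Jacobi operator along the gradient\<close>

lemma dd_matrix_vector:
  fixes M :: "real^'d \<Rightarrow> real^'d^'d"
  assumes "Ck_on 1 S M" "x \<in> S"
  shows "dd M x u *v v = dd (\<lambda>y. M y *v v) x u"
proof -
  have "linear (\<lambda>A::real^'d^'d. A *v v)"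
    by (rule linearI) (simp_all add: matrix_vector_mult_add_rdistrib scaleR_matrix_vector_assoc)
  from dd_linear[OF this, of M x u] show ?thesis using assms by simp
qed

text \<open>The connection matrix along V. The covariant derivative along V of an operator field M
  is its coordinate derivative plus A M - M A.\<close>

abbreviation "A x \<equiv> matrix (Gam G x (V x))"
abbreviation "D x \<equiv> matrix (\<lambda>v. dd F x v *\<^sub>R V x)"

lemma A_mult: "A x *v v = Gam G x (V x) v"
  by (simp add: matrix_works linear_Gam(2))

lemma D_mult: "x \<in> S \<Longrightarrow> D x *v v = dd F x v *\<^sub>R V x"
proof -
  assume x: "x \<in> S"
  have l: "linear (dd F x)" by (rule linear_dd[OF F_differentiable[OF x]])
  have "linear (\<lambda>v. dd F x v *\<^sub>R V x)"
    by (rule linearI) (simp_all add: linear_add[OF l] linear_scale[OF l] scaleR_left_distrib)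
  then show ?thesis by (simp add: matrix_works)
qed

text \<open>The identity \<nabla>_V V = (b'/2)V is differentiated in direction v. Exchanging the
  order of the two derivatives of V produces the curvature term; differentiating the factor b'/2
  produces the rank-one term with b''.\<close>

lemma Riccati:
  assumes x: "x \<in> S"
  shows "dd H x (V x) = - K x - H x ** H x + (b1 (F x) / 2) *\<^sub>R H x + (b2 (F x) / 2) *\<^sub>R D x
    + (H x ** A x - A x ** H x)"
proof -
  have x': "x \<in> \<Omega>" using x S_subset by blast
  let ?W = "V x" and ?c = "b1 (F x) / 2"
  have dV: "(\<lambda>y. dd V y a) differentiable (at x)" for a
    using Ck_gradient[of 2] x by (simp add: numeral_2_eq_2)
  have Vx: "V differentiable (at x)" by (rule V_differentiable[OF x])
  have sV: "dd V y (V y) = (b1 (F y) / 2) *\<^sub>R V y - Gam G y (V y) (V y)" if "y \<in> S" for y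
    using hessian_gradient[OF that] by (simp add: dd_gradient[OF that])
  have "dd H x ?W *v v = (- K x - H x ** H x + ?c *\<^sub>R H x + (b2 (F x) / 2) *\<^sub>R D x
    + (H x ** A x - A x ** H x)) *v v" for v
  proof -
    let ?D = "dd V x v"
    have c: "(\<lambda>y. b1 (F y) / 2) differentiable (at x)"
      "dd (\<lambda>y. b1 (F y) / 2) x v = b2 (F x) / 2 * dd F x v"
    proof -
      note ch = dd_chain_real[OF F_differentiable[OF x] b_differentiable(2)]
      have l: "linear (\<lambda>t::real. t / 2)" by (rule linearI) (simp_all add: add_divide_distrib)
      show "dd (\<lambda>y. b1 (F y) / 2) x v = b2 (F x) / 2 * dd F x v"
        using dd_linear[OF l ch(1)] ch(2) by (simp add: b2_def)
      show "(\<lambda>y. b1 (F y) / 2) differentiable (at x)"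
        by (rule differentiable_divide[OF ch(1) differentiable_const]) simp
    qed
    have "dd (\<lambda>y. dd V y (V y)) x v = dd (\<lambda>y. (b1 (F y) / 2) *\<^sub>R V y - Gam G y (V y) (V y)) x v"
      by (rule dd_cong[OF differentiable_linear_family[where L="\<lambda>y. dd V y", OF open_S x _ dV Vx] open_S x])
         (simp_all add: sV linear_dd V_differentiable)
    moreover have "dd (\<lambda>y. dd V y (V y)) x v = dd (\<lambda>y. dd V y ?W) x v + dd V x ?D"
      by (rule dd_linear_family[where L="\<lambda>y. dd V y", OF open_S x _ dV Vx])
         (simp add: linear_dd V_differentiable)
    moreover have "dd (\<lambda>y. (b1 (F y) / 2) *\<^sub>R V y - Gam G y (V y) (V y)) x v =
        ?c *\<^sub>R ?D + (b2 (F x) / 2 * dd F x v) *\<^sub>R ?W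
        - (dd (\<lambda>y. Gam G y ?W ?W) x v + Gam G x ?D ?W + Gam G x ?W ?D)"
      using dd_diff[OF differentiable_bilinear[OF bounded_bilinear_scaleR c(1) Vx] dd_Gam_fields(1)[OF x' Vx Vx]]
        dd_bilinear[OF bounded_bilinear_scaleR c(1) Vx] dd_Gam_fields(2)[OF x' Vx Vx] c(2)
      by simp
    \<comment> \<open>The two expansions of the derivative of \<open>dd V y (V y)\<close> are solved
      for the part in which the inner direction is frozen at \<open>V x\<close>; it is the second
      derivative of V occurring in the derivative of H.\<close>
    ultimately have second: "dd (\<lambda>y. dd V y ?W) x v = ?c *\<^sub>R ?D + (b2 (F x) / 2 * dd F x v) *\<^sub>R ?W
        - (dd (\<lambda>y. Gam G y ?W ?W) x v + Gam G x ?D ?W + Gam G x ?W ?D) - dd V x ?D"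
      by (simp add: algebra_simps)
    have "dd H x ?W *v v = dd (\<lambda>y. H y *v v) x ?W"
      by (rule dd_matrix_vector[OF Ck_hessian x])
    also have "\<dots> = dd (\<lambda>y. dd V y v + Gam G y v (V y)) x ?W"
      by (rule dd_cong[symmetric, OF _ open_S x])
         (simp_all add: hessian_mult differentiable_add dV dd_Gam_fields(1)[OF x' _ Vx])
    also have "\<dots> = dd (\<lambda>y. dd V y v) x ?W + dd (\<lambda>y. Gam G y v (V y)) x ?W"
      by (rule dd_add[OF dV dd_Gam_fields(1)[OF x' _ Vx]]) simp
    \<comment> \<open>After this exchange, the derivatives of \<open>Gam\<close> in directions v and
      V, together with the products of two \<open>Gam\<close>, make up - R(V, v)V.\<close>
    also have "dd (\<lambda>y. dd V y v) x ?W = dd (\<lambda>y. dd V y ?W) x v"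
      by (rule dd_dd_commute[OF open_S x Ck_gradient])
    also have "dd (\<lambda>y. Gam G y v (V y)) x ?W = dd (\<lambda>y. Gam G y v ?W) x ?W + Gam G x v (dd V x ?W)"
      using dd_Gam_fields(2)[OF x' _ Vx, of "\<lambda>_. v" ?W] by (simp add: Gam_simps)
    finally have 1: "dd H x ?W *v v = dd (\<lambda>y. dd V y ?W) x v
        + (dd (\<lambda>y. Gam G y v ?W) x ?W + Gam G x v (dd V x ?W))" .
    have dVD: "dd V x ?D = H x *v ?D - Gam G x ?W ?D"
      using dd_gradient[OF x, of ?D] Gam_sym[OF x', of ?D ?W] by simp
    have dVW: "dd V x ?W = ?c *\<^sub>R ?W - Gam G x ?W ?W"
      using dd_gradient[OF x, of ?W] hessian_gradient[OF x] by simp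
    have Dv: "?D = H x *v v - Gam G x ?W v"
      using dd_gradient[OF x, of v] Gam_sym[OF x', of v ?W] by simp
    have g1: "Gam G x ?D ?W = Gam G x ?W ?D" by (rule Gam_sym[OF x'])
    have g2: "Gam G x v ?W = Gam G x ?W v" by (rule Gam_sym[OF x'])
    have mm: "(M ** M') *v v = M *v (M' *v v)" for M M' :: "real^'d^'d"
      by (simp add: matrix_vector_mul_assoc)
    have lhs: "dd H x ?W *v v = ?c *\<^sub>R ?D + (b2 (F x) / 2 * dd F x v) *\<^sub>R ?W
        - dd (\<lambda>y. Gam G y ?W ?W) x v - Gam G x ?W ?D - H x *v ?D
        + dd (\<lambda>y. Gam G y v ?W) x ?W + ?c *\<^sub>R Gam G x ?W v - Gam G x v (Gam G x ?W ?W)"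
      unfolding 1 second dVD dVW g1 Gam_simps g2 by (simp add: algebra_simps)
    have rhs: "(- K x - H x ** H x + ?c *\<^sub>R H x + (b2 (F x) / 2) *\<^sub>R D x
        + (H x ** A x - A x ** H x)) *v v =
        - Riem G x ?W v ?W - H x *v (H x *v v) + ?c *\<^sub>R (H x *v v)
        + (b2 (F x) / 2 * dd F x v) *\<^sub>R ?W + (H x *v Gam G x ?W v - Gam G x ?W (H x *v v))"
      by (simp add: matrix_vector_mult_add_rdistrib matrix_vector_mult_diff_rdistrib
          scaleR_matrix_vector_assoc[symmetric] mm A_mult D_mult[OF x] jacobi_mult[OF x, symmetric]
          matrix_vector_mult_minus)
    show ?thesis
      unfolding lhs rhs Dv Riem_def Gam_simps
      by (simp add: g2 matrix_vector_mult_diff_distrib algebra_simps)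
  qed
  then show ?thesis by (simp add: matrix_eq)
qed

lemma trace_D_mult: "x \<in> S \<Longrightarrow> trace (D x ** M) = dd F x (M *v V x)"
  by (rule trace_rank_one_mult[OF linear_dd[OF F_differentiable]])

lemma jacobi_gradient: "x \<in> S \<Longrightarrow> K x *v V x = 0"
  by (simp add: jacobi_mult Riem_def)

text \<open>The Riccati equation makes the usual appeal to the Bianchi identity unnecessary: all its other terms
  are self-adjoint, the covariant derivative of the Hessian by metric compatibility.\<close>

lemma jacobi_self_adjoint:
  assumes x: "x \<in> S"
  shows "self_adjoint (G x) (K x)"
proof -
  have x': "x \<in> \<Omega>" using x S_subset by blast
  note G = inner_matrix[OF x']
  note sym = inner_matrixD(1)[OF G]
  have Hsa: "form (G x) (H x *v u) w = form (G x) u (H x *v w)" for u w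
    using hessian_self_adjoint[OF x] by (simp add: self_adjoint_def)
  let ?W = "V x"
  have l: "linear (\<lambda>B. form B a w)" for a w :: "real^'d"
    by (rule linearI) (simp_all add: form_matrix_simps)
  have dH: "(\<lambda>y. H y *v u) differentiable (at x)" for u
  proof -
    have "linear (\<lambda>B::real^'d^'d. B *v u)"
      by (rule linearI) (simp_all add: matrix_vector_mult_add_rdistrib scaleR_matrix_vector_assoc)
    from Ck_on_linear[OF open_S this Ck_hessian] show ?thesis
      by (rule Ck_on_differentiable[OF _ x])
  qed
  have dG: "(\<lambda>y. form (G y) a w) differentiable (at x)" for a w
    by (rule Ck_on_differentiable[OF Ck_on_linear[OF open_dom l Ck_metric] x'])
  have left: "dd (\<lambda>y. form (G y) (H y *v u) w) x ?W =
      form (dd G x ?W) (H x *v u) w + form (G x) (dd H x ?W *v u) w"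
    and dfl: "(\<lambda>y. form (G y) (H y *v u) w) differentiable (at x)" for u w
  proof -
    have ly: "linear (\<lambda>a. form (G y) a w)" for y by (rule linearI) (simp_all add: form_simps)
    have "dd (\<lambda>y. form (G y) (H y *v u) w) x ?W =
        dd (\<lambda>y. form (G y) (H x *v u) w) x ?W + form (G x) (dd (\<lambda>y. H y *v u) x ?W) w"
      by (rule dd_linear_family[where L="\<lambda>y a. form (G y) a w", OF open_S x ly dG dH])
    then show "dd (\<lambda>y. form (G y) (H y *v u) w) x ?W =
      form (dd G x ?W) (H x *v u) w + form (G x) (dd H x ?W *v u) w"
      by (simp add: dd_linear[OF l metric_differentiable[OF x']] dd_matrix_vector[OF Ck_hessian x])
    show "(\<lambda>y. form (G y) (H y *v u) w) differentiable (at x)"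
      by (rule differentiable_linear_family[where L="\<lambda>y a. form (G y) a w", OF open_S x ly dG dH])
  qed
  have swap: "dd (\<lambda>y. form (G y) (H y *v u) w) x ?W = dd (\<lambda>y. form (G y) (H y *v w) u) x ?W" for u w
  proof (rule dd_cong[OF dfl open_S x])
    fix y assume y: "y \<in> S"
    show "form (G y) (H y *v u) w = form (G y) (H y *v w) u"
      using hessian_self_adjoint[OF y] inner_matrixD(1)[OF inner_matrix, of y u "H y *v w"] y S_subset
        inner_matrixD(1)[OF inner_matrix, of y "H y *v w" u]
      unfolding self_adjoint_def by auto
  qed
  \<comment> \<open>T is the covariant derivative of H along V. Differentiating the symmetry of g(H
    u, w) shows, by metric compatibility, that T is self-adjoint.\<close>
  define T where "T = dd H x ?W - (H x ** A x - A x ** H x)"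
  have Tsym: "form (G x) (T *v u) w = form (G x) (T *v w) u" for u w
  proof -
    have "form (G x) (T *v u) w = form (G x) (dd H x ?W *v u) w
        - form (G x) (Gam G x ?W u) (H x *v w) + form (G x) (Gam G x ?W (H x *v u)) w" for u w
      by (simp add: T_def matrix_vector_mult_diff_rdistrib matrix_vector_mul_assoc[symmetric]
          A_mult form_simps Hsa)
    moreover have "form (G x) (dd H x ?W *v u) w + form (G x) (Gam G x ?W (H x *v u)) w =
        dd (\<lambda>y. form (G y) (H y *v u) w) x ?W - form (G x) (H x *v u) (Gam G x ?W w)" for u w
      unfolding left metric_compatible[OF x'] by simp
    ultimately have "form (G x) (T *v u) w = dd (\<lambda>y. form (G y) (H y *v u) w) x ?W
        - form (G x) (H x *v u) (Gam G x ?W w) - form (G x) (Gam G x ?W u) (H x *v w)" for u w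
      by (simp add: algebra_simps)
    then show ?thesis using swap[of u w] sym[of "Gam G x ?W u" "H x *v w"] sym[of "Gam G x ?W w" "H x *v u"] by simp
  qed
  have KT: "K x = - T - H x ** H x + (b1 (F x) / 2) *\<^sub>R H x + (b2 (F x) / 2) *\<^sub>R D x"
    using Riccati[OF x] by (simp add: T_def algebra_simps)
  have "form (G x) (K x *v u) w = form (G x) (K x *v w) u" for u w
  proof -
    have "form (G x) (K x *v u) w = - form (G x) (T *v u) w - form (G x) (H x *v u) (H x *v w)
        + b1 (F x) / 2 * form (G x) (H x *v u) w + b2 (F x) / 2 * (dd F x u * dd F x w)" for u w
      by (simp add: KT matrix_vector_mult_add_rdistrib matrix_vector_mult_diff_rdistrib
          scaleR_matrix_vector_assoc[symmetric] matrix_vector_mult_minus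
          matrix_vector_mul_assoc[symmetric] D_mult[OF x] form_simps form_minus form_gradient[OF x] Hsa)
    then show ?thesis
      using Tsym[of u w] sym[of "H x *v u" "H x *v w"] sym[of "H x *v w" u] Hsa[of u w] by simp
  qed
  then show ?thesis
    unfolding self_adjoint_def using sym by metis
qed

text \<open>As the curvature is parallel, only the two slots filled by V vary covariantly. There
  \<nabla>_V V = (b'/2)V, so each contributes half of b' K.\<close>

lemma jacobi_derivative:
  assumes par: parallel_curv and x: "x \<in> S"
  shows "dd K x (V x) = b1 (F x) *\<^sub>R K x + (K x ** A x - A x ** K x)"
proof -
  have x': "x \<in> \<Omega>" using x S_subset by blast
  have S_sub: "y \<in> \<Omega>" if "y \<in> S" for y using that S_subset by blast
  let ?W = "V x"
  let ?E = "dd V x ?W"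
  have Vx: "V differentiable (at x)" by (rule V_differentiable[OF x])
  have dR: "(\<lambda>y. Riem G y a v c) differentiable (at x)" for a v c
    by (rule Ck_on_differentiable[OF Ck_Riem x'])
  have E: "?E = (b1 (F x) / 2) *\<^sub>R ?W - Gam G x ?W ?W"
    using dd_gradient[OF x, of ?W] hessian_gradient[OF x] by simp
  have "dd K x ?W *v v = (b1 (F x) *\<^sub>R K x + (K x ** A x - A x ** K x)) *v v" for v
  proof -
    have d1: "(\<lambda>y. Riem G y a v (V y)) differentiable (at x)"
      "dd (\<lambda>y. Riem G y a v (V y)) x ?W = dd (\<lambda>y. Riem G y a v ?W) x ?W + Riem G x a v ?E" for a
      by (rule differentiable_linear_family[where L="\<lambda>y. Riem G y a v", OF open_S x linear_Riem(3)[OF S_sub] dR Vx]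
          dd_linear_family[where L="\<lambda>y. Riem G y a v", OF open_S x linear_Riem(3)[OF S_sub] dR Vx]; assumption)+
    have "dd (\<lambda>y. Riem G y (V y) v (V y)) x ?W =
        dd (\<lambda>y. Riem G y ?W v (V y)) x ?W + Riem G x ?E v ?W"
      by (rule dd_linear_family[where L="\<lambda>y a. Riem G y a v (V y)", OF open_S x linear_Riem(1)[OF S_sub] d1(1) Vx])
    moreover have "dd K x ?W *v v = dd (\<lambda>y. K y *v v) x ?W"
      by (rule dd_matrix_vector[OF Ck_jacobi x])
    moreover have "dd (\<lambda>y. K y *v v) x ?W = dd (\<lambda>y. Riem G y (V y) v (V y)) x ?W"
      by (rule dd_cong[symmetric, OF Ck_on_differentiable[OF Ck_Riem_gradient x] open_S x])
         (simp add: jacobi_mult)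
    ultimately have 1: "dd K x ?W *v v = dd (\<lambda>y. Riem G y ?W v ?W) x ?W + Riem G x ?W v ?E + Riem G x ?E v ?W"
      by (simp add: d1(2))
    note l1 = linear_Riem(1)[OF x'] and l3 = linear_Riem(3)[OF x']
    have 2: "Riem G x ?W v ?E = (b1 (F x) / 2) *\<^sub>R Riem G x ?W v ?W - Riem G x ?W v (Gam G x ?W ?W)"
      unfolding E by (simp only: linear_diff[OF l3] linear_scale[OF l3])
    have 3: "Riem G x ?E v ?W = (b1 (F x) / 2) *\<^sub>R Riem G x ?W v ?W - Riem G x (Gam G x ?W ?W) v ?W"
      unfolding E using linear_diff[OF l1] linear_scale[OF l1] by metis
    have half: "(r / 2) *\<^sub>R z + (r / 2) *\<^sub>R z = r *\<^sub>R z" for r and z :: "real^'d"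
      by (simp add: scaleR_left_distrib[symmetric])
    have "dd K x ?W *v v = ((b1 (F x) / 2) *\<^sub>R Riem G x ?W v ?W + (b1 (F x) / 2) *\<^sub>R Riem G x ?W v ?W)
        + (Riem G x ?W (Gam G x ?W v) ?W - Gam G x ?W (Riem G x ?W v ?W))"
      unfolding 1 2 3 parallel_Riem[OF par x'] by (simp add: algebra_simps)
    then show ?thesis
      unfolding half
      by (simp add: matrix_vector_mult_add_rdistrib matrix_vector_mult_diff_rdistrib
          scaleR_matrix_vector_assoc[symmetric] matrix_vector_mul_assoc[symmetric] A_mult jacobi_mult[OF x])
  qed
  then show ?thesis by (simp add: matrix_eq)
qed

section \<open>Derivatives of the traces along the gradient\<close>

lemma trace_differentiable:
  assumes "\<And>k. Ck_on k S M" "x \<in> S"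
  shows "(\<lambda>y. trace (M y :: real^'d^'d)) differentiable (at x)"
  by (rule Ck_on_differentiable[OF Ck_on_trace[OF open_S assms(1)] assms(2)])

lemma dd_trace:
  assumes "\<And>k. Ck_on k S M" "x \<in> S"
  shows "dd (\<lambda>y. trace (M y :: real^'d^'d)) x u = trace (dd M x u)"
  by (rule dd_linear[OF linear_trace Ck_on_differentiable[OF assms(1,2)]])

lemma dd_matrix_mult:
  fixes M N :: "real^'d \<Rightarrow> real^'d^'d"
  assumes "\<And>k. Ck_on k S M" "\<And>k. Ck_on k S N" "x \<in> S"
  shows "dd (\<lambda>y. M y ** N y) x u = M x ** dd N x u + dd M x u ** N x"
  by (rule dd_bilinear[OF bounded_bilinear_matrix_mult
        Ck_on_differentiable[OF assms(1,3)] Ck_on_differentiable[OF assms(2,3)]])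

lemma Ck_HH: "Ck_on k S (\<lambda>y. H y ** H y)" and Ck_HHH: "Ck_on k S (\<lambda>y. H y ** H y ** H y)"
  and Ck_KH: "Ck_on k S (\<lambda>y. K y ** H y)"
  by (intro Ck_on_matrix_mult Ck_hessian Ck_jacobi open_S)+

text \<open>In this and the next two lemmas the term with \<open>b2\<close> comes from D: the trace
  of D H^j is dF(H^j V) = (b'/2)^j b, because V is an eigenvector of H. The commutators have trace
  zero against powers of H.\<close>

lemma dd_trace_hessian:
  assumes x: "x \<in> S"
  shows "dd (\<lambda>y. trace (H y)) x (V x) = - trace (K x) - trace (H x ** H x)
    + b1 (F x) / 2 * trace (H x) + b2 (F x) / 2 * b (F x)"
proof -
  have "trace (D x) = b (F x)"
    using trace_D_mult[OF x, of "mat 1"] dd_F_gradient[OF x] by simp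
  moreover have "trace (H x ** A x - A x ** H x) = 0"
    using trace_commutator[of "H x" "mat 1" "A x"] by simp
  ultimately show ?thesis
    unfolding dd_trace[OF Ck_hessian x] Riccati[OF x] trace_simps by simp
qed

lemma dd_trace_hessian2:
  assumes x: "x \<in> S"
  shows "dd (\<lambda>y. trace (H y ** H y)) x (V x) = 2 * (- trace (K x ** H x) - trace (H x ** H x ** H x)
    + b1 (F x) / 2 * trace (H x ** H x) + b2 (F x) / 2 * (b1 (F x) / 2) * b (F x))"
proof -
  let ?H' = "dd H x (V x)"
  have "trace (D x ** H x) = b1 (F x) / 2 * b (F x)"
    by (simp add: trace_D_mult[OF x] hessian_gradient[OF x] linear_scale[OF linear_dd[OF F_differentiable[OF x]]]
        dd_F_gradient[OF x])
  moreover have "trace ((H x ** A x - A x ** H x) ** H x) = 0"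
    by (rule trace_commutator) simp
  ultimately have "trace (?H' ** H x) = - trace (K x ** H x) - trace (H x ** H x ** H x)
    + b1 (F x) / 2 * trace (H x ** H x) + b2 (F x) / 2 * (b1 (F x) / 2) * b (F x)"
    unfolding Riccati[OF x] matrix_mult_simps(1,5,7) trace_simps matrix_mult_simps(3)[of "- K x"] by simp
  moreover have "trace (H x ** ?H') = trace (?H' ** H x)" by (rule trace_mul_sym)
  ultimately show ?thesis
    unfolding dd_trace[OF Ck_HH x] dd_matrix_mult[OF Ck_hessian Ck_hessian x] trace_simps by simp
qed

lemma dd_trace_hessian3:
  assumes x: "x \<in> S"
  shows "dd (\<lambda>y. trace (H y ** H y ** H y)) x (V x) =
    3 * (- trace (K x ** H x ** H x) - trace (H x ** H x ** H x ** H x)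
    + b1 (F x) / 2 * trace (H x ** H x ** H x) + b2 (F x) / 2 * (b1 (F x) / 2)\<^sup>2 * b (F x))"
proof -
  let ?H' = "dd H x (V x)"
  have "trace (D x ** (H x ** H x)) = (b1 (F x) / 2)\<^sup>2 * b (F x)"
    by (simp add: trace_D_mult[OF x] matrix_vector_mul_assoc[symmetric] hessian_gradient[OF x]
        matrix_vector_mult_scaleR linear_scale[OF linear_dd[OF F_differentiable[OF x]]]
        dd_F_gradient[OF x] power2_eq_square)
  moreover have "trace ((H x ** A x - A x ** H x) ** (H x ** H x)) = 0"
    by (rule trace_commutator) (simp add: matrix_mul_assoc)
  ultimately have "trace (?H' ** (H x ** H x)) =
    - trace (K x ** (H x ** H x)) - trace ((H x ** H x) ** (H x ** H x))
    + b1 (F x) / 2 * trace (H x ** (H x ** H x)) + b2 (F x) / 2 * (b1 (F x) / 2)\<^sup>2 * b (F x)"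
    unfolding Riccati[OF x] matrix_mult_simps(1,5,7) trace_simps matrix_mult_simps(3)[of "- K x"] by simp
  then have 1: "trace (?H' ** H x ** H x) =
    - trace (K x ** H x ** H x) - trace (H x ** H x ** H x ** H x)
    + b1 (F x) / 2 * trace (H x ** H x ** H x) + b2 (F x) / 2 * (b1 (F x) / 2)\<^sup>2 * b (F x)"
    by (simp only: matrix_mul_assoc)
  have 2: "trace (H x ** H x ** ?H') = trace (?H' ** H x ** H x)"
    by (subst trace_mul_sym) (simp only: matrix_mul_assoc)
  have "trace (H x ** ?H' ** H x) = trace (H x ** (?H' ** H x))" by (simp only: matrix_mul_assoc)
  also have "\<dots> = trace (?H' ** H x ** H x)" by (rule trace_mul_sym)
  finally show ?thesis
    unfolding dd_trace[OF Ck_HHH x] dd_matrix_mult[OF Ck_HH Ck_hessian x]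
      dd_matrix_mult[OF Ck_hessian Ck_hessian x] matrix_mult_simps(1) trace_simps 1 2 by simp
qed

text \<open>The coefficient 3/2 is 1 from K' plus 1/2 from H'. D drops out because K V = 0. K and H
  need not commute, so the two commutator terms are cancelled against each other rather than one by
  one.\<close>

lemma dd_trace_jacobi_hessian:
  assumes par: parallel_curv and x: "x \<in> S"
  shows "dd (\<lambda>y. trace (K y ** H y)) x (V x) = 3 / 2 * b1 (F x) * trace (K x ** H x)
    - trace (K x ** K x) - trace (K x ** H x ** H x)"
proof -
  have "trace (K x ** D x) = trace (D x ** K x)" by (rule trace_mul_sym)
  also have "\<dots> = 0"
    by (simp add: trace_D_mult[OF x] jacobi_gradient[OF x] linear_0[OF linear_dd[OF F_differentiable[OF x]]])
  finally have "trace (K x ** dd H x (V x)) = - trace (K x ** K x) - trace (K x ** H x ** H x)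
      + b1 (F x) / 2 * trace (K x ** H x) + trace (K x ** (H x ** A x - A x ** H x))"
    unfolding Riccati[OF x] matrix_mult_simps(2,6,8) trace_simps matrix_mult_simps(4)[of "K x" "- K x"]
    by (simp add: matrix_mul_assoc)
  moreover have "trace (dd K x (V x) ** H x) = b1 (F x) * trace (K x ** H x)
      + trace ((K x ** A x - A x ** K x) ** H x)"
    unfolding jacobi_derivative[OF par x] matrix_mult_simps(1,5) trace_simps by simp
  moreover have "trace (K x ** (H x ** A x - A x ** H x)) + trace ((K x ** A x - A x ** K x) ** H x) = 0"
  proof -
    have "trace (K x ** H x ** A x) = trace (A x ** (K x ** H x))" by (rule trace_mul_sym)
    then show ?thesis by (simp add: matrix_mult_simps trace_simps matrix_mul_assoc)
  qed
  ultimately show ?thesis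
    unfolding dd_trace[OF Ck_KH x] dd_matrix_mult[OF Ck_jacobi Ck_hessian x] trace_simps by simp
qed

end

section \<open>Functions that are constant on the level sets\<close>

text \<open>Near x the function F is strictly increasing along the line in direction v, and \<theta>
  inverts it there. The curve \<open>x + \<theta> y *\<^sub>R v\<close> thus meets each level y in
  [l, u]; it serves both for differentiating functions of the level and for proving them
  continuous.\<close>

lemma transversal_curve:
  fixes F :: "'a::euclidean_space \<Rightarrow> real"
  assumes S: "open S" "x \<in> S" and F: "Ck_on 1 S F" and v: "dd F x v > 0"
  obtains l u \<theta> where "l < F x" "F x < u" "\<theta> (F x) = 0"
    "(\<theta> has_real_derivative inverse (dd F x v)) (at (F x))" "continuous_on {l..u} \<theta>"
    "\<And>y. y \<in> {l..u} \<Longrightarrow> x + \<theta> y *\<^sub>R v \<in> S \<and> F (x + \<theta> y *\<^sub>R v) = y"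
proof -
  have dF: "F differentiable (at y)" if "y \<in> S" for y using F that by simp
  have cont: "continuous_on S (\<lambda>y. dd F y v)" using F by simp
  define T where "T = {y \<in> S. dd F y v > 0}"
  have "open T"
    using continuous_open_preimage[OF cont S(1) open_greaterThan[of 0]]
    by (simp add: T_def vimage_def Int_def greaterThan_def)
  have "open ((\<lambda>s::real. x + s *\<^sub>R v) -` T)"
    by (rule open_vimage[OF \<open>open T\<close>]) (intro continuous_intros)
  moreover have "0 \<in> (\<lambda>s::real. x + s *\<^sub>R v) -` T" using S v by (simp add: T_def)
  ultimately obtain d where d: "d > 0" "cball 0 d \<subseteq> (\<lambda>s::real. x + s *\<^sub>R v) -` T"
    using open_contains_cball by blast
  have T: "x + s *\<^sub>R v \<in> T" if "s \<in> {-d..d}" for s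
    using d(2) that by (auto simp: subset_eq abs_le_iff)
  define \<phi> where "\<phi> s = F (x + s *\<^sub>R v)" for s
  have der: "(\<phi> has_real_derivative dd F (x + s *\<^sub>R v) v) (at s)" if "s \<in> {-d..d}" for s
    unfolding \<phi>_def by (rule has_real_derivative_along_line[OF dF]) (use T[OF that] in \<open>simp add: T_def\<close>)
  have c\<phi>: "continuous_on {-d..d} \<phi>"
    using der DERIV_isCont by (intro continuous_at_imp_continuous_on) blast
  have mono: "\<phi> r < \<phi> s" if "-d \<le> r" "r < s" "s \<le> d" for r s
  proof (rule DERIV_pos_imp_increasing[OF that(2)])
    fix t assume "r \<le> t" "t \<le> s"
    then have t: "t \<in> {-d..d}" using that by auto
    show "\<exists>y. (\<phi> has_real_derivative y) (at t) \<and> y > 0"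
      using der[OF t] T[OF t] by (auto simp: T_def)
  qed
  have inj: "inj_on \<phi> {-d..d}"
  proof (rule inj_onI)
    fix r s assume "r \<in> {-d..d}" "s \<in> {-d..d}" "\<phi> r = \<phi> s"
    then show "r = s" using mono[of r s] mono[of s r] by (cases r s rule: linorder_cases) auto
  qed
  define \<theta> where "\<theta> = inv_into {-d..d} \<phi>"
  have \<theta>: "\<theta> (\<phi> s) = s" if "s \<in> {-d..d}" for s
    unfolding \<theta>_def by (rule inv_into_f_f[OF inj that])
  have surj: "\<exists>s\<in>{-d..d}. \<phi> s = y" if "y \<in> {\<phi> (-d)..\<phi> d}" for y
    using IVT'[of \<phi> "-d" y d] that d(1) c\<phi> by auto
  have x0: "\<phi> 0 = F x" by (simp add: \<phi>_def)
  show thesis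
  proof
    show "\<phi> (-d) < F x" "F x < \<phi> d" using mono[of "-d" 0] mono[of 0 d] d(1) x0 by auto
    show "\<theta> (F x) = 0" using \<theta>[of 0] d(1) x0 by simp
    have "continuous_on (\<phi> ` {-d..d}) \<theta>"
      by (rule continuous_on_inv[OF c\<phi> compact_Icc]) (use \<theta> in auto)
    then show cont\<theta>: "continuous_on {\<phi> (-d)..\<phi> d} \<theta>"
      by (rule continuous_on_subset) (use surj in blast)
    show "(\<theta> has_real_derivative inverse (dd F x v)) (at (F x))"
    proof (rule DERIV_inverse_function)
      show "(\<phi> has_real_derivative dd F x v) (at (\<theta> (F x)))"
        using der[of 0] d(1) \<theta>[of 0] x0 by simp
      show "dd F x v \<noteq> 0" using v by simp
      show l: "\<phi> (-d) < F x" and u: "F x < \<phi> d"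
        using mono[of "-d" 0] mono[of 0 d] d(1) x0 by auto
      show "\<phi> (\<theta> y) = y" if "\<phi> (-d) < y" "y < \<phi> d" for y
        using surj[of y] \<theta> that by auto
      show "isCont \<theta> (F x)"
        by (rule continuous_on_interior[OF cont\<theta>]) (use l u in simp)
    qed
    fix y assume "y \<in> {\<phi> (-d)..\<phi> d}"
    then obtain s where s: "s \<in> {-d..d}" "\<phi> s = y" using surj by blast
    then have "\<theta> y = s" using \<theta> by blast
    then show "x + \<theta> y *\<^sub>R v \<in> S \<and> F (x + \<theta> y *\<^sub>R v) = y"
      using s T[OF s(1)] by (simp add: T_def \<phi>_def)
  qed
qed

text \<open>Nothing is assumed about q itself: on the transversal curve q(y) equals Q at the curve
  point, so q inherits its derivative from Q and \<theta> by the chain rule.\<close>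

lemma fibre_derivative:
  fixes F Q :: "'a::euclidean_space \<Rightarrow> real"
  assumes S: "open S" "x \<in> S" and F: "Ck_on 1 S F" and v: "dd F x v > 0"
    and Q: "Q differentiable (at x)" "\<And>y. y \<in> S \<Longrightarrow> Q y = q (F y)"
  shows "(q has_real_derivative dd Q x v / dd F x v) (at (F x))"
proof -
  obtain l u \<theta> where lu: "l < F x" "F x < u" and \<theta>: "\<theta> (F x) = 0"
    "(\<theta> has_real_derivative inverse (dd F x v)) (at (F x))"
    "\<And>y. y \<in> {l..u} \<Longrightarrow> x + \<theta> y *\<^sub>R v \<in> S \<and> F (x + \<theta> y *\<^sub>R v) = y"
    using transversal_curve[OF S F v] by metis
  have "((\<lambda>s. Q (x + s *\<^sub>R v)) has_real_derivative dd Q x v) (at (\<theta> (F x)))"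
    using has_real_derivative_along_line[of Q x 0 v] Q(1) \<theta>(1) by simp
  from DERIV_chain2[OF this \<theta>(2)]
  have "((\<lambda>y. Q (x + \<theta> y *\<^sub>R v)) has_real_derivative dd Q x v / dd F x v) (at (F x))"
    by (simp add: divide_inverse)
  then show ?thesis
    by (rule has_field_derivative_transform_within_open[where S="{l<..<u}"])
       (use lu \<theta>(3) Q(2) in auto)
qed

lemma (in chart_metric) jacobi_op_scale:
  assumes x: "x \<in> \<Omega>"
  shows "jacobi_op G x (r *\<^sub>R a) = (r * r) *\<^sub>R jacobi_op G x a"
proof -
  have "Riem G x (r *\<^sub>R a) v (r *\<^sub>R a) = (r * r) *\<^sub>R Riem G x a v a" for v
    using linear_scale[OF linear_Riem(1)[OF x], of r a v "r *\<^sub>R a"]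
      linear_scale[OF linear_Riem(3)[OF x], of a v r a] by simp
  then show ?thesis
    by (simp add: matrix_eq jacobi_op_mult[OF x] scaleR_matrix_vector_assoc[symmetric])
qed

text \<open>K is quadratic in its vector, so K_V = b K_\<xi> for the unit vector \<xi> along V.
  Self-adjointness of K_V passes to K_\<xi>, whose sigmas then give the trace and the trace of the
  square.\<close>

lemma (in chart_function) trace_jacobi:
  assumes x: "x \<in> S" and pos: "b (F x) > 0"
    and C1: "\<And>\<xi>. metric_at G x \<xi> \<xi> = 1 \<Longrightarrow> sigma_op 1 (jacobi_op G x \<xi>) = C1"
    and C2: "\<And>\<xi>. metric_at G x \<xi> \<xi> = 1 \<Longrightarrow> sigma_op 2 (jacobi_op G x \<xi>) = C2"
  shows "trace (K x) = b (F x) * C1"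
    and "trace (K x ** K x) = (b (F x))\<^sup>2 * (C1\<^sup>2 - 2 * C2)"
proof -
  have x': "x \<in> \<Omega>" using x S_subset by blast
  define r where "r = sqrt (b (F x))"
  have r: "r > 0" "r * r = b (F x)" using pos by (simp_all add: r_def)
  define \<xi> where "\<xi> = inverse r *\<^sub>R V x"
  have "metric_at G x \<xi> \<xi> = 1"
    using r pos norm_gradient[OF x] by (simp add: metric_at_form \<xi>_def form_simps field_simps)
  note C = C1[OF this] C2[OF this]
  have sa: "self_adjoint (G x) (jacobi_op G x \<xi>)"
    using jacobi_self_adjoint[OF x]
    by (simp add: \<xi>_def jacobi_op_scale[OF x'] self_adjoint_def scaleR_matrix_vector_assoc[symmetric] form_simps)
  note s = self_adjoint_sigma_op(1,2)[OF inner_matrix[OF x'] sa]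
  have "V x = r *\<^sub>R \<xi>" using r by (simp add: \<xi>_def)
  then have K: "K x = b (F x) *\<^sub>R jacobi_op G x \<xi>"
    using jacobi_op_scale[OF x', of r \<xi>] r by simp
  show "trace (K x) = b (F x) * C1"
    using s C by (simp add: K trace_simps)
  have "trace (jacobi_op G x \<xi> ** jacobi_op G x \<xi>) = C1\<^sup>2 - 2 * C2"
    using s C by simp
  then show "trace (K x ** K x) = (b (F x))\<^sup>2 * (C1\<^sup>2 - 2 * C2)"
    by (simp add: K matrix_mult_simps trace_simps power2_eq_square)
qed

section \<open>Functions of the level, treated in all charts at once\<close>

locale chart_family =
  fixes C :: "'c set" and \<Omega> :: "'c \<Rightarrow> (real^'d::finite) set" and G :: "'c \<Rightarrow> 'd metric_field"
    and S :: "'c \<Rightarrow> (real^'d) set" and F :: "'c \<Rightarrow> real^'d \<Rightarrow> real" and b :: "real \<Rightarrow> real"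
    and C1 C2 :: real
  assumes chart: "c \<in> C \<Longrightarrow> chart_function (\<Omega> c) (G c) (S c) (F c) b"
    and pos: "c \<in> C \<Longrightarrow> x \<in> S c \<Longrightarrow> b (F c x) > 0"
    and parallel: "c \<in> C \<Longrightarrow> chart_metric.parallel_curv (\<Omega> c) (G c)"
    and sigma1: "c \<in> C \<Longrightarrow> x \<in> S c \<Longrightarrow> metric_at (G c) x \<xi> \<xi> = 1 \<Longrightarrow> sigma_op 1 (jacobi_op (G c) x \<xi>) = C1"
    and sigma2: "c \<in> C \<Longrightarrow> x \<in> S c \<Longrightarrow> metric_at (G c) x \<xi> \<xi> = 1 \<Longrightarrow> sigma_op 2 (jacobi_op (G c) x \<xi>) = C2"
begin

abbreviation "grad c \<equiv> gradient (G c) (F c)"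
abbreviation "Hess c \<equiv> hessian_op (G c) (F c)"
abbreviation "Jac c x \<equiv> jacobi_op (G c) x (grad c x)"

text \<open>A level set may run through several charts, so one q has to serve them all. No
  regularity is demanded of q.\<close>

definition level :: "('c \<Rightarrow> real^'d \<Rightarrow> real) \<Rightarrow> bool" where
  "level Q \<longleftrightarrow> (\<exists>q. \<forall>c\<in>C. \<forall>x\<in>S c. Q c x = q (F c x))"

lemma levelI: "(\<And>c x. c \<in> C \<Longrightarrow> x \<in> S c \<Longrightarrow> Q c x = q (F c x)) \<Longrightarrow> level Q"
  unfolding level_def by blast

text \<open>By \<open>fibre_derivative\<close> along V, where dF(V) = b > 0, the function q has
  derivative dQ(V)/b. Hence dQ(V) = q' b, an expression in the level with the same q in every
  chart.\<close>

lemma level_derivative: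
  assumes Q: "level Q" and dQ: "\<And>c x. c \<in> C \<Longrightarrow> x \<in> S c \<Longrightarrow> Q c differentiable (at x)"
  shows "level (\<lambda>c x. dd (Q c) x (grad c x))"
proof -
  obtain q where q: "\<And>c x. c \<in> C \<Longrightarrow> x \<in> S c \<Longrightarrow> Q c x = q (F c x)"
    using Q unfolding level_def by blast
  show ?thesis
  proof (rule levelI)
    fix c x assume c: "c \<in> C" and x: "x \<in> S c"
    interpret chart_function "\<Omega> c" "G c" "S c" "F c" b by (rule chart[OF c])
    have d: "dd (F c) x (grad c x) = b (F c x)" by (rule dd_F_gradient[OF x])
    have "(q has_real_derivative dd (Q c) x (grad c x) / dd (F c) x (grad c x)) (at (F c x))"
      by (rule fibre_derivative[OF open_S x Ck_F _ dQ[OF c x] q[OF c]]) (use d pos[OF c x] in simp_all)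
    then show "dd (Q c) x (grad c x) = (\<lambda>t. deriv q t * b t) (F c x)"
      using pos[OF c x] d by (simp add: DERIV_imp_deriv)
  qed
qed

lemma level_sigma_hessian2:
  assumes s1: "level (\<lambda>c x. sigma_op 1 (Hess c x))"
  shows "level (\<lambda>c x. sigma_op 2 (Hess c x))"
proof -
  obtain p1 where p1: "\<And>c x. c \<in> C \<Longrightarrow> x \<in> S c \<Longrightarrow> sigma_op 1 (Hess c x) = p1 (F c x)"
    using s1 unfolding level_def by blast
  have sa: "inner_matrix (G c x)" "self_adjoint (G c x) (Hess c x)" if c: "c \<in> C" and x: "x \<in> S c" for c x
  proof -
    interpret chart_function "\<Omega> c" "G c" "S c" "F c" b by (rule chart[OF c])
    show "inner_matrix (G c x)" "self_adjoint (G c x) (Hess c x)"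
      using x S_subset by (auto intro: inner_matrix hessian_self_adjoint)
  qed
  have t1: "trace (Hess c x) = p1 (F c x)" if "c \<in> C" "x \<in> S c" for c x
    using self_adjoint_sigma_op(1)[OF sa[OF that]] p1[OF that] by simp
  have "level (\<lambda>c x. dd (\<lambda>y. trace (Hess c y)) x (grad c x))"
  proof (rule level_derivative)
    show "level (\<lambda>c x. trace (Hess c x))" by (rule levelI) (rule t1)
    show "(\<lambda>y. trace (Hess c y)) differentiable (at x)" if c: "c \<in> C" and x: "x \<in> S c" for c x
    proof -
      interpret chart_function "\<Omega> c" "G c" "S c" "F c" b by (rule chart[OF c])
      show ?thesis by (rule trace_differentiable[OF Ck_hessian x])
    qed
  qed
  then obtain r where r: "\<And>c x. c \<in> C \<Longrightarrow> x \<in> S c \<Longrightarrow> dd (\<lambda>y. trace (Hess c y)) x (grad c x) = r (F c x)"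
    unfolding level_def by blast
  \<comment> \<open>The trace of H^2, obtained by solving \<open>dd_trace_hessian\<close> for it
    with tr K = b C1.\<close>
  define p2 where "p2 t = - r t - b t * C1 + chart_function.b1 b t / 2 * p1 t + chart_function.b2 b t / 2 * b t" for t
  show ?thesis
  proof (rule levelI)
    fix c x assume c: "c \<in> C" and x: "x \<in> S c"
    interpret chart_function "\<Omega> c" "G c" "S c" "F c" b by (rule chart[OF c])
    have "trace (Hess c x ** Hess c x) = p2 (F c x)"
      using dd_trace_hessian[OF x] r[OF c x] t1[OF c x]
        trace_jacobi(1)[OF x pos[OF c x] sigma1[OF c x] sigma2[OF c x]]
      by (simp add: p2_def)
    then show "sigma_op 2 (Hess c x) = (\<lambda>t. ((p1 t)\<^sup>2 - p2 t) / 2) (F c x)"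
      using self_adjoint_sigma_op(2)[OF sa[OF c x]] t1[OF c x] by simp
  qed
qed

lemma level_sigma_hessian4:
  assumes s1: "level (\<lambda>c x. sigma_op 1 (Hess c x))" and s2: "level (\<lambda>c x. sigma_op 2 (Hess c x))"
    and s3: "level (\<lambda>c x. sigma_op 3 (Hess c x))"
  shows "level (\<lambda>c x. sigma_op 4 (Hess c x))"
proof -
  obtain a1 where a1: "\<And>c x. c \<in> C \<Longrightarrow> x \<in> S c \<Longrightarrow> sigma_op 1 (Hess c x) = a1 (F c x)"
    using s1 unfolding level_def by blast
  obtain a2 where a2: "\<And>c x. c \<in> C \<Longrightarrow> x \<in> S c \<Longrightarrow> sigma_op 2 (Hess c x) = a2 (F c x)"
    using s2 unfolding level_def by blast
  obtain a3 where a3: "\<And>c x. c \<in> C \<Longrightarrow> x \<in> S c \<Longrightarrow> sigma_op 3 (Hess c x) = a3 (F c x)"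
    using s3 unfolding level_def by blast
  have sa: "inner_matrix (G c x)" "self_adjoint (G c x) (Hess c x)" if c: "c \<in> C" and x: "x \<in> S c" for c x
  proof -
    interpret chart_function "\<Omega> c" "G c" "S c" "F c" b by (rule chart[OF c])
    show "inner_matrix (G c x)" "self_adjoint (G c x) (Hess c x)"
      using x S_subset by (auto intro: inner_matrix hessian_self_adjoint)
  qed
  \<comment> \<open>The second and third power sums of the eigenvalues, from Newton's identities
    solved for them.\<close>
  define p2 where "p2 t = (a1 t)\<^sup>2 - 2 * a2 t" for t
  define p3 where "p3 t = (6 * a3 t - a1 t ^ 3 + 3 * a1 t * p2 t) / 2" for t
  have t1: "trace (Hess c x) = a1 (F c x)"
    and t2: "trace (Hess c x ** Hess c x) = p2 (F c x)"
    and t3: "trace (Hess c x ** Hess c x ** Hess c x) = p3 (F c x)" if "c \<in> C" "x \<in> S c" for c x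
    using self_adjoint_sigma_op(1,2,3)[OF sa[OF that]] a1[OF that] a2[OF that] a3[OF that]
    by (simp_all add: p2_def p3_def)
  have dif: "(\<lambda>y. trace (Hess c y ** Hess c y)) differentiable (at x)"
    "(\<lambda>y. trace (Hess c y ** Hess c y ** Hess c y)) differentiable (at x)"
    "(\<lambda>y. trace (Jac c y ** Hess c y)) differentiable (at x)" if c: "c \<in> C" and x: "x \<in> S c" for c x
  proof -
    interpret chart_function "\<Omega> c" "G c" "S c" "F c" b by (rule chart[OF c])
    show "(\<lambda>y. trace (Hess c y ** Hess c y)) differentiable (at x)"
      "(\<lambda>y. trace (Hess c y ** Hess c y ** Hess c y)) differentiable (at x)"
      "(\<lambda>y. trace (Jac c y ** Hess c y)) differentiable (at x)"
      by (rule trace_differentiable[OF Ck_HH x] trace_differentiable[OF Ck_HHH x]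
          trace_differentiable[OF Ck_KH x])+
  qed
  have "level (\<lambda>c x. trace (Hess c x ** Hess c x))"
    by (rule levelI) (rule t2)
  from this dif(1) have "level (\<lambda>c x. dd (\<lambda>y. trace (Hess c y ** Hess c y)) x (grad c x))"
    by (rule level_derivative)
  then obtain r2 where r2: "\<And>c x. c \<in> C \<Longrightarrow> x \<in> S c \<Longrightarrow>
      dd (\<lambda>y. trace (Hess c y ** Hess c y)) x (grad c x) = r2 (F c x)"
    unfolding level_def by blast
  \<comment> \<open>The trace of K H, obtained by solving \<open>dd_trace_hessian2\<close> for
    it.\<close>
  define kh where "kh t = - r2 t / 2 - p3 t + chart_function.b1 b t / 2 * p2 t
    + chart_function.b2 b t / 2 * (chart_function.b1 b t / 2) * b t" for t
  have tkh: "trace (Jac c x ** Hess c x) = kh (F c x)" if c: "c \<in> C" and x: "x \<in> S c" for c x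
  proof -
    interpret chart_function "\<Omega> c" "G c" "S c" "F c" b by (rule chart[OF c])
    show ?thesis
      using dd_trace_hessian2[OF x] r2[OF c x] t2[OF c x] t3[OF c x]
      by (simp add: kh_def field_simps)
  qed
  have "level (\<lambda>c x. trace (Jac c x ** Hess c x))"
    by (rule levelI) (rule tkh)
  from this dif(3) have "level (\<lambda>c x. dd (\<lambda>y. trace (Jac c y ** Hess c y)) x (grad c x))"
    by (rule level_derivative)
  then obtain rk where rk: "\<And>c x. c \<in> C \<Longrightarrow> x \<in> S c \<Longrightarrow>
      dd (\<lambda>y. trace (Jac c y ** Hess c y)) x (grad c x) = rk (F c x)"
    unfolding level_def by blast
  have "level (\<lambda>c x. trace (Hess c x ** Hess c x ** Hess c x))"
    by (rule levelI) (rule t3)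
  from this dif(2) have "level (\<lambda>c x. dd (\<lambda>y. trace (Hess c y ** Hess c y ** Hess c y)) x (grad c x))"
    by (rule level_derivative)
  then obtain r3 where r3: "\<And>c x. c \<in> C \<Longrightarrow> x \<in> S c \<Longrightarrow>
      dd (\<lambda>y. trace (Hess c y ** Hess c y ** Hess c y)) x (grad c x) = r3 (F c x)"
    unfolding level_def by blast
  \<comment> \<open>The trace of K H^2, from \<open>dd_trace_jacobi_hessian\<close> with tr K^2 =
    b^2 (C1^2 - 2 C2). It is the remaining unknown in \<open>dd_trace_hessian3\<close> besides the
    trace of H^4, which becomes \<open>p4\<close>.\<close>
  define khh where "khh t = 3 / 2 * chart_function.b1 b t * kh t - (b t)\<^sup>2 * (C1\<^sup>2 - 2 * C2) - rk t" for t
  define p4 where "p4 t = - r3 t / 3 - khh t + chart_function.b1 b t / 2 * p3 t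
    + chart_function.b2 b t / 2 * (chart_function.b1 b t / 2)\<^sup>2 * b t" for t
  show ?thesis
  proof (rule levelI)
    fix c x assume c: "c \<in> C" and x: "x \<in> S c"
    interpret chart_function "\<Omega> c" "G c" "S c" "F c" b by (rule chart[OF c])
    have "trace (Jac c x ** Hess c x ** Hess c x) = khh (F c x)"
      using dd_trace_jacobi_hessian[OF parallel[OF c] x] rk[OF c x] tkh[OF c x]
        trace_jacobi(2)[OF x pos[OF c x] sigma1[OF c x] sigma2[OF c x]]
      by (simp add: khh_def)
    then have "trace (Hess c x ** Hess c x ** Hess c x ** Hess c x) = p4 (F c x)"
      using dd_trace_hessian3[OF x] r3[OF c x] t3[OF c x]
      by (simp add: p4_def field_simps)
    then show "sigma_op 4 (Hess c x) = (\<lambda>t. (a1 t ^ 4 - 6 * a1 t ^ 2 * p2 t + 3 * p2 t ^ 2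
        + 8 * a1 t * p3 t - 6 * p4 t) / 24) (F c x)"
      using self_adjoint_sigma_op(4)[OF sa[OF c x]] t1[OF c x] t2[OF c x] t3[OF c x] by simp
  qed
qed

end

section \<open>Passage from charts to the manifold\<close>

text \<open>Being functions of the level says nothing about continuity in the level. This continuity
  on the chart is later transported to the real line along a transversal curve.\<close>

lemma (in chart_function) continuous_on_sigma_hessian:
  "continuous_on S (\<lambda>x. sigma_op 2 (H x))" "continuous_on S (\<lambda>x. sigma_op 4 (H x))"
proof -
  have c: "continuous_on S (\<lambda>x. trace (H x))" "continuous_on S (\<lambda>x. trace (H x ** H x))"
    "continuous_on S (\<lambda>x. trace (H x ** H x ** H x))"
    "continuous_on S (\<lambda>x. trace (H x ** H x ** H x ** H x))"
    by (intro Ck_on_continuous[of 0] Ck_on_trace Ck_on_matrix_mult Ck_hessian open_S)+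
  have s: "sigma_op 2 (H x) = (trace (H x) ^ 2 - trace (H x ** H x)) / 2"
    "sigma_op 4 (H x) = (trace (H x) ^ 4 - 6 * trace (H x) ^ 2 * trace (H x ** H x) + 3 * trace (H x ** H x) ^ 2
      + 8 * trace (H x) * trace (H x ** H x ** H x) - 6 * trace (H x ** H x ** H x ** H x)) / 24"
    if "x \<in> S" for x
    using self_adjoint_sigma_op(2,4)[OF inner_matrix hessian_self_adjoint[OF that]] that S_subset by auto
  have "continuous_on S (\<lambda>x. (trace (H x) ^ 2 - trace (H x ** H x)) / 2)"
    by (intro continuous_intros c) simp
  then show "continuous_on S (\<lambda>x. sigma_op 2 (H x))"
    by (rule continuous_on_eq) (simp add: s)
  have "continuous_on S (\<lambda>x. (trace (H x) ^ 4 - 6 * trace (H x) ^ 2 * trace (H x ** H x) + 3 * trace (H x ** H x) ^ 2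
      + 8 * trace (H x) * trace (H x ** H x ** H x) - 6 * trace (H x ** H x ** H x ** H x)) / 24)"
    by (intro continuous_intros c) simp
  then show "continuous_on S (\<lambda>x. sigma_op 4 (H x))"
    by (rule continuous_on_eq) (simp add: s)
qed

context riemannian_manifold
begin

lemma chart_inj: "c \<in> \<A> \<Longrightarrow> inj_on (cmap c) (cdom c)"
  using homeomorphic_imp_injective_map[OF chart_homeomorphic] chart_open openin_subset
  by (metis topspace_subtopology_subset)

lemma cinv_cmap: "c \<in> \<A> \<Longrightarrow> p \<in> cdom c \<Longrightarrow> cinv c (cmap c p) = p"
  by (rule inv_into_f_f[OF chart_inj])

lemma chart_image_open:
  assumes c: "c \<in> \<A>" and U: "openin N U"
  shows "open (cmap c ` (U \<inter> cdom c))"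
proof -
  have "openin (subtopology N (cdom c)) (U \<inter> cdom c)"
    using U by (rule openin_subtopology_Int)
  then have "openin (top_of_set (cmap c ` cdom c)) (cmap c ` (U \<inter> cdom c))"
    using homeomorphic_imp_open_map[OF chart_homeomorphic[OF c]] by (simp add: open_map_def)
  then show ?thesis using chart_open[OF c] openin_open_eq by blast
qed

lemma chart_preimage_open:
  assumes c: "c \<in> \<A>" and W: "open W"
  shows "openin N {p \<in> cdom c. cmap c p \<in> W}"
proof -
  have t: "topspace (subtopology N (cdom c)) = cdom c"
    using chart_open[OF c] openin_subset by (metis topspace_subtopology_subset)
  have "openin (top_of_set (cmap c ` cdom c)) (cmap c ` cdom c \<inter> W)"
    using W by (rule openin_open_Int)
  from openin_continuous_map_preimage[OF homeomorphic_imp_continuous_map[OF chart_homeomorphic[OF c]] this]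
  have "openin (subtopology N (cdom c)) {p \<in> cdom c. cmap c p \<in> cmap c ` cdom c \<inter> W}"
    unfolding t .
  moreover have "{p \<in> cdom c. cmap c p \<in> cmap c ` cdom c \<inter> W} = {p \<in> cdom c. cmap c p \<in> W}" by auto
  ultimately have "openin (subtopology N (cdom c)) {p \<in> cdom c. cmap c p \<in> W}" by simp
  then show ?thesis by (rule openin_trans_full) (use chart_open[OF c] in blast)
qed

lemma chart_metric_chart:
  assumes c: "c \<in> \<A>" shows "chart_metric (cmap c ` cdom c) (g c)"
proof
  show "open (cmap c ` cdom c)" using chart_open[OF c] by blast
  show "smooth_on (cmap c ` cdom c) (g c)" by (rule metric_smooth[OF c])
  show "inner_matrix (g c x)" if "x \<in> cmap c ` cdom c" for x
    using metric_sym[OF c that] metric_pos[OF c that] by (simp add: inner_matrix_def metric_at_form)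
qed

text \<open>The same f is used on a smaller open set: a slab around the level t on which b > 0. Two
  things must be restored there, namely that f is not constant, and that the new coefficient is
  continuous on the whole real line.\<close>

lemma isoparametric_step:
  assumes sym: "locally_symmetric \<A> g"
    and s1: "jacobi_sigma_constant \<A> g 1" and s2: "jacobi_sigma_constant \<A> g 2"
    and k: "k = 1 \<or> k = 3" "k + 1 < CARD('d)"
    and iso: "isoparametric_hypersurface N \<A> g k M"
  shows "isoparametric_hypersurface N \<A> g (k + 1) M"
proof -
  from s1[unfolded jacobi_sigma_constant_def]
  obtain C1 where C1: "\<forall>c\<in>\<A>. \<forall>x\<in>cmap c ` cdom c. \<forall>\<xi>.
    metric_at (g c) x \<xi> \<xi> = 1 \<longrightarrow> sigma_op 1 (jacobi_op (g c) x \<xi>) = C1" ..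
  from s2[unfolded jacobi_sigma_constant_def]
  obtain C2 where C2: "\<forall>c\<in>\<A>. \<forall>x\<in>cmap c ` cdom c. \<forall>\<xi>.
    metric_at (g c) x \<xi> \<xi> = 1 \<longrightarrow> sigma_op 2 (jacobi_op (g c) x \<xi>) = C2" ..
  obtain U f t where f: "isoparametric_function N \<A> g k U f" and reg: "regular_value \<A> U f t"
    and M: "M = {p \<in> U. f p = t}" "M \<noteq> {}"
    using iso unfolding isoparametric_hypersurface_def by blast
  define F where "F c = f \<circ> cinv c" for c :: "('p, 'd) chart"
  have U: "openin N U" and smooth_f: "\<And>c. c \<in> \<A> \<Longrightarrow> smooth_on (cmap c ` (U \<inter> cdom c)) (F c)"
    using f by (auto simp: isoparametric_function_def F_def)
  obtain b :: "real \<Rightarrow> real" and a where b: "smooth_on UNIV b" and a: "\<forall>i\<in>{1..k}. continuous_on UNIV (a i)"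
    and norm: "\<And>c p. c \<in> \<A> \<Longrightarrow> p \<in> U \<inter> cdom c \<Longrightarrow>
      metric_at (g c) (cmap c p) (gradient (g c) (F c) (cmap c p)) (gradient (g c) (F c) (cmap c p)) = b (f p)"
    and sig: "\<And>c p i. c \<in> \<A> \<Longrightarrow> p \<in> U \<inter> cdom c \<Longrightarrow> i \<in> {1..k} \<Longrightarrow>
      sigma_op i (hessian_op (g c) (F c) (cmap c p)) = a i (f p)"
    using f unfolding isoparametric_function_def Let_def F_def by blast
  have F: "F c (cmap c p) = f p" if "c \<in> \<A>" "p \<in> cdom c" for c p
    using cinv_cmap[OF that] by (simp add: F_def)
  define S0 where "S0 c = cmap c ` (U \<inter> cdom c)" for c :: "('p, 'd) chart"
  have S0: "open (S0 c)" "S0 c \<subseteq> cmap c ` cdom c" if "c \<in> \<A>" for c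
    using chart_image_open[OF that U] by (auto simp: S0_def)
  have cf: "chart_function (cmap c ` cdom c) (g c) T (F c) b"
    if c: "c \<in> \<A>" and T: "open T" "T \<subseteq> S0 c" for c T
  proof -
    interpret chart_metric "cmap c ` cdom c" "g c" by (rule chart_metric_chart[OF c])
    show ?thesis
    proof
      show "open T" "T \<subseteq> cmap c ` cdom c" using T S0(2)[OF c] by auto
      show "smooth_on T (F c)" using smooth_on_subset[OF smooth_f[OF c]] T(2) by (simp add: S0_def)
      show "smooth_on UNIV b" by (rule b)
      fix x assume "x \<in> T"
      then obtain p where "p \<in> U \<inter> cdom c" "x = cmap c p" using T(2) by (auto simp: S0_def)
      then show "form (g c x) (gradient (g c) (F c) x) (gradient (g c) (F c) x) = b (F c x)"
        using norm[OF c] F[OF c] by (simp add: metric_at_form)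
    qed
  qed
  obtain p0 where p0: "p0 \<in> U" "f p0 = t" using M by blast
  then obtain c0 where c0: "c0 \<in> \<A>" "p0 \<in> cdom c0"
    using covering openin_subset[OF U] by blast
  define x0 where "x0 = cmap c0 p0"
  have x0: "x0 \<in> S0 c0" "F c0 x0 = t" using p0 c0 F by (auto simp: S0_def x0_def)
  interpret c0: chart_function "cmap c0 ` cdom c0" "g c0" "S0 c0" "F c0" b
    by (rule cf[OF c0(1) S0(1)[OF c0(1)]]) simp
  define v where "v = gradient (g c0) (F c0) x0"
  \<comment> \<open>This is the only use of t being a regular value; it gives b(t) > 0 because b(t)
    is the squared length of v.\<close>
  have "v \<noteq> 0"
  proof
    assume "v = 0"
    then have "dd (F c0) x0 w = 0" for w
      using c0.form_gradient[OF x0(1), of w] by (simp add: v_def form_simps)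
    moreover have "frechet_derivative (f \<circ> cinv c0) (at (cmap c0 p0)) \<noteq> (\<lambda>_. 0)"
      using reg p0 c0 unfolding regular_value_def by blast
    ultimately show False by (auto simp: F_def x0_def fun_eq_iff)
  qed
  then have bt: "b t > 0"
    using c0.norm_gradient[OF x0(1)] inner_matrixD(2)[OF c0.inner_matrix] x0 S0(2)[OF c0(1)]
    unfolding v_def by (metis subsetD)
  have "continuous_on UNIV b" using b Ck_on_continuous[of 0] unfolding smooth_on_def by blast
  then have "open {s. 0 < b s}" by (intro open_Collect_less continuous_on_const)
  then obtain e where e: "e > 0" "ball t e \<subseteq> {s. 0 < b s}"
    using bt open_contains_ball by (metis mem_Collect_eq)
  \<comment> \<open>Confining the curve to T0 forces b > 0 at all levels in [l, u], as each of them
    is attained on the curve.\<close>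
  define T0 where "T0 = {x \<in> S0 c0. F c0 x \<in> ball t e}"
  have contF: "continuous_on (S0 c) (F c)" if c: "c \<in> \<A>" for c
    by (rule Ck_on_continuous[OF chart_function.Ck_F[OF cf[OF c S0(1)[OF c]]]]) simp
  have preim: "open {x \<in> S0 c. F c x \<in> J}" if c: "c \<in> \<A>" and "open J" for c J
    using continuous_open_preimage[OF contF[OF c] S0(1)[OF c] \<open>open J\<close>]
    by (simp add: vimage_def Int_def)
  have oT: "open T0" unfolding T0_def by (rule preim[OF c0(1)]) simp
  have xT: "x0 \<in> T0" using x0 e by (simp add: T0_def)
  have dv: "dd (F c0) x0 v > 0" using c0.dd_F_gradient[OF x0(1)] bt x0 by (simp add: v_def)
  have "Ck_on 1 T0 (F c0)" by (rule Ck_on_subset[OF c0.Ck_F]) (auto simp: T0_def)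
  from transversal_curve[OF oT xT this dv]
  obtain l u \<theta> where lu: "l < t" "t < u" and \<theta>: "continuous_on {l..u} \<theta>"
    and curve: "\<And>y. y \<in> {l..u} \<Longrightarrow> x0 + \<theta> y *\<^sub>R v \<in> T0 \<and> F c0 (x0 + \<theta> y *\<^sub>R v) = y"
    using x0(2) by metis
  have b_pos: "b y > 0" if "y \<in> {l..u}" for y
    using curve[OF that] e(2) by (auto simp: T0_def)
  define U' where "U' = {p \<in> U. f p \<in> {l<..<u}}"
  define S where "S c = cmap c ` (U' \<inter> cdom c)" for c :: "('p, 'd) chart"
  have S_eq: "S c = {x \<in> S0 c. F c x \<in> {l<..<u}}" if c: "c \<in> \<A>" for c
    unfolding S_def S0_def U'_def using F[OF c] by auto
  have S: "open (S c)" "S c \<subseteq> S0 c" if c: "c \<in> \<A>" for c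
    unfolding S_eq[OF c] by (rule preim[OF c open_greaterThanLessThan]) blast
  have U': "openin N U'"
  proof -
    \<comment> \<open>The regularity of f is given in charts only, so the slab is shown to be open
      as a union of chart preimages.\<close>
    have "U' = (\<Union>c\<in>\<A>. {p \<in> cdom c. cmap c p \<in> S c})"
    proof
      show "U' \<subseteq> (\<Union>c\<in>\<A>. {p \<in> cdom c. cmap c p \<in> S c})"
        using covering openin_subset[OF U] by (fastforce simp: U'_def S_def)
      show "(\<Union>c\<in>\<A>. {p \<in> cdom c. cmap c p \<in> S c}) \<subseteq> U'"
        using chart_inj by (auto simp: S_def inj_on_def)
    qed
    then show ?thesis using chart_preimage_open S(1) by auto
  qed
  have fam: "chart_family \<A> (\<lambda>c. cmap c ` cdom c) g S F b C1 C2"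
  proof (rule chart_family.intro)
    fix c assume c: "c \<in> \<A>"
    show "chart_function (cmap c ` cdom c) (g c) (S c) (F c) b" by (rule cf[OF c S[OF c]])
    show "chart_metric.parallel_curv (cmap c ` cdom c) (g c)"
      using sym c unfolding chart_metric.parallel_curv_def[OF chart_metric_chart[OF c]] locally_symmetric_def
      by blast
    fix x assume x: "x \<in> S c"
    then have x': "x \<in> cmap c ` cdom c" using S(2)[OF c] S0(2)[OF c] by blast
    show "b (F c x) > 0" using x b_pos by (simp add: S_eq[OF c])
    show "sigma_op 1 (jacobi_op (g c) x \<xi>) = C1" if "metric_at (g c) x \<xi> \<xi> = 1" for \<xi>
      by (rule C1[rule_format, OF c x' that])
    show "sigma_op 2 (jacobi_op (g c) x \<xi>) = C2" if "metric_at (g c) x \<xi> \<xi> = 1" for \<xi>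
      by (rule C2[rule_format, OF c x' that])
  qed
  interpret fam: chart_family \<A> "\<lambda>c. cmap c ` cdom c" g S F b C1 C2 by (rule fam)
  have lev: "fam.level (\<lambda>c x. sigma_op i (hessian_op (g c) (F c) x))" if i: "i \<in> {1..k}" for i
  proof (rule fam.levelI)
    fix c x assume c: "c \<in> \<A>" and "x \<in> S c"
    then obtain p where "p \<in> U \<inter> cdom c" "x = cmap c p" by (auto simp: S_def U'_def)
    then show "sigma_op i (hessian_op (g c) (F c) x) = a i (F c x)"
      using sig[OF c _ i] F[OF c] by simp
  qed
  have "fam.level (\<lambda>c x. sigma_op (k + 1) (hessian_op (g c) (F c) x))"
    using k(1)
  proof
    assume "k = 1"
    then show ?thesis using fam.level_sigma_hessian2 lev[of 1] by (simp add: numeral_2_eq_2)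
  next
    assume "k = 3"
    then show ?thesis using fam.level_sigma_hessian4 lev[of 1] lev[of 2] lev[of 3] by simp
  qed
  then obtain q where q: "\<And>c x. c \<in> \<A> \<Longrightarrow> x \<in> S c \<Longrightarrow>
      sigma_op (k + 1) (hessian_op (g c) (F c) x) = q (F c x)"
    unfolding fam.level_def by blast
  define \<sigma> where "\<sigma> x = sigma_op (k + 1) (hessian_op (g c0) (F c0) x)" for x
  have cont\<sigma>: "continuous_on (S0 c0) \<sigma>"
    using k(1) c0.continuous_on_sigma_hessian by (auto simp: \<sigma>_def[abs_def] numeral_2_eq_2)
  \<comment> \<open>The value s is clamped to [l, u], so the curve, and with it q', is defined and
    continuous for all real s. At the end points the curve leaves the slab but stays in
    \<open>S0 c0\<close>, where \<sigma> is still continuous; agreement with q holds on the open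
    interval, which contains all values of f on U'.\<close>
  define q' where "q' s = \<sigma> (x0 + \<theta> (max l (min u s)) *\<^sub>R v)" for s
  have clamp: "max l (min u s) \<in> {l..u}" for s using lu by auto
  have "continuous_on UNIV (\<lambda>s. \<theta> (max l (min u s)))"
    by (rule continuous_on_compose2[OF \<theta>]) (use clamp in \<open>auto intro!: continuous_intros\<close>)
  then have "continuous_on UNIV (\<lambda>s. x0 + \<theta> (max l (min u s)) *\<^sub>R v)"
    by (intro continuous_intros)
  then have cont_q': "continuous_on UNIV q'"
    unfolding q'_def[abs_def]
    by (rule continuous_on_compose2[OF cont\<sigma>]) (use curve[OF clamp] in \<open>auto simp: T0_def\<close>)
  have q'_q: "q' s = q s" if s: "s \<in> {l<..<u}" for s
  proof -
    have "max l (min u s) = s" using s by auto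
    moreover have "x0 + \<theta> s *\<^sub>R v \<in> S c0" "F c0 (x0 + \<theta> s *\<^sub>R v) = s"
      using curve[of s] s by (auto simp: S_eq[OF c0(1)] T0_def)
    ultimately show ?thesis using q[OF c0(1)] by (simp add: q'_def \<sigma>_def)
  qed
  have nonconst: "\<not> f constant_on U'"
  proof
    assume "f constant_on U'"
    then obtain y where y: "\<And>p. p \<in> U' \<Longrightarrow> f p = y" unfolding constant_on_def by blast
    have "s = y" if s: "s \<in> {l<..<u}" for s
    proof -
      have "x0 + \<theta> s *\<^sub>R v \<in> S c0" "F c0 (x0 + \<theta> s *\<^sub>R v) = s"
        using curve[of s] s by (auto simp: S_eq[OF c0(1)] T0_def)
      then obtain p where "p \<in> U'" "f p = s" using F[OF c0(1)] by (auto simp: S_def)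
      then show ?thesis using y by blast
    qed
    \<comment> \<open>Two distinct levels of the slab, both attained on the curve.\<close>
    from this[of t] this[of "(t + u) / 2"] show False using lu by simp
  qed
  define a' where "a' i = (if i = k + 1 then q' else a i)" for i
  have "isoparametric_function N \<A> g (k + 1) U' f"
    unfolding isoparametric_function_def
  proof (intro conjI ballI exI[of _ b] exI[of _ a'])
    show "1 \<le> k + 1" "k + 1 < CARD('d)" "openin N U'" "\<not> f constant_on U'" "smooth_on UNIV b"
      using k(2) U' nonconst b by auto
    show "smooth_on (cmap c ` (U' \<inter> cdom c)) (f \<circ> cinv c)" if "c \<in> \<A>" for c
      using smooth_on_subset[OF smooth_f[OF that], unfolded F_def] image_mono[of "U' \<inter> cdom c" "U \<inter> cdom c" "cmap c"]
      unfolding U'_def by blast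
    show "continuous_on UNIV (a' i)" if "i \<in> {1..k + 1}" for i
      using that a cont_q' by (auto simp: a'_def)
    fix c p assume c: "c \<in> \<A>" and p: "p \<in> U' \<inter> cdom c"
    have pU: "p \<in> U \<inter> cdom c" using p by (simp add: U'_def)
    have "sigma_op i (hessian_op (g c) (F c) (cmap c p)) = a' i (f p)" if i: "i \<in> {1..k + 1}" for i
    proof (cases "i = k + 1")
      case True
      have "cmap c p \<in> S c" using p by (simp add: S_def)
      from q[OF c this] show ?thesis
        using True q'_q[of "f p"] p F[OF c, of p] by (simp add: a'_def U'_def)
    next
      case False
      then show ?thesis using sig[OF c pU, of i] i by (simp add: a'_def)
    qed
    then show "let x = cmap c p; F = f \<circ> cinv c in
        metric_at (g c) x (gradient (g c) F x) (gradient (g c) F x) = b (f p) \<and>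
        (\<forall>i\<in>{1..k + 1}. sigma_op i (hessian_op (g c) F x) = a' i (f p))"
      using norm[OF c pU] by (simp add: Let_def F_def)
  qed
  moreover have "regular_value \<A> U' f t"
    using reg by (auto simp: regular_value_def U'_def)
  moreover have "M = {p \<in> U'. f p = t}" using M(1) lu by (auto simp: U'_def)
  ultimately show ?thesis
    using M(2) unfolding isoparametric_hypersurface_def by blast
qed

end

theorem corollary4p1:
  fixes N :: "'p topology"
    and \<A> :: "('p, 'd::finite) chart set"
    and g :: "('p, 'd) chart \<Rightarrow> 'd metric_field"
    and n :: nat
  assumes "riemannian_manifold N \<A> g"
    and "CARD('d) = n + 1"
    and "locally_symmetric \<A> g"
    and "jacobi_sigma_constant \<A> g 1"
    and "jacobi_sigma_constant \<A> g 2"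
  shows "(n \<ge> 2 \<longrightarrow> (\<forall>M. isoparametric_hypersurface N \<A> g 1 M \<longrightarrow>
                        isoparametric_hypersurface N \<A> g 2 M)) \<and>
         (n \<ge> 4 \<longrightarrow> (\<forall>M. isoparametric_hypersurface N \<A> g 3 M \<longrightarrow>
                        isoparametric_hypersurface N \<A> g 4 M))"
proof -
  interpret riemannian_manifold N \<A> g by (rule assms(1))
  note step = isoparametric_step[OF assms(3,4,5)]
  show ?thesis
  proof (intro conjI impI allI)
    fix M assume "n \<ge> 2" "isoparametric_hypersurface N \<A> g 1 M"
    then show "isoparametric_hypersurface N \<A> g 2 M"
      using step[of 1 M] assms(2) by (simp add: numeral_2_eq_2)
  next
    fix M assume "n \<ge> 4" "isoparametric_hypersurface N \<A> g 3 M"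
    then show "isoparametric_hypersurface N \<A> g 4 M"
      using step[of 3 M] assms(2) by simp
  qed
qed

end
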